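(* Let $k>1$ and consider the domain $\mathcal{D}=\mathcal{D}_k=\{(x,y)\in\mathbb{R}^2:0\le x\le1,\ 0\le y\le x^k\}$, with $d=2$, $t=(0,0)$ and $\rho=1$. Let $(s,L)\in(0,\infty)^2$ be given. Define $$s_k=\mathop{\mathrm{arg\,max}}_{\beta\in(0,s]}\theta_k(\beta),\quad\text{where}\quad\theta_k(\beta)=\frac{\beta-2(\lceil\beta\rceil-1)(k-1)}{2\beta+k+1}.$$ The following assertions hold: 1. There exists a positive real constant $C(s,L,k)$ such that, for any $f\in\Sigma(s,L)$ and any $n\in\mathbb{N}$, $$R_n(\hat f_{\gamma_k},f)\le C(s,L,k)\,n^{-\theta_k(s_k)},$$ where $\gamma_k=(m,h)$ with $m=\lceil s_k\rceil-1$ and $h=n^{-1/(2s_k+k+1)}$. 2. Assume further that $s\in(0,1]$. Then there exists a positive real constant $c(s,L,k)$ such that, for any $n\in\mathbb{N}$, $$\inf_{\tilde f}\sup_{f\in\Sigma(s,L)}R_n(\tilde f,f)\ge c(s,L,k)\,n^{-\theta_k(s)},$$ the infimum being over all estimators. In particular, $\{n^{-s/(2s+k+1)}:n\in\mathbb{N}\}$ is the minimax rate of convergence on $\Sigma(s,L)$ as soon as $s\in(0,1]$.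
   Context: Setting. With $d=2$, $\mathcal{D}=\mathcal{D}_k$, $t=(0,0)$, $\rho=1$: $\|\cdot\|_\infty$ is the sup norm on $\mathbb{R}^2$, $\Delta=[-1,1]^2$ and $\mathcal{V}(h)=\{u\in\mathbb{R}^2:t+u\in\mathcal{D},\ \|u\|_\infty\le h\}$. $X_1,\dots,X_n$ are i.i.d. random variables supported on $\mathcal{D}$ with density $f$ with respect to Lebesgue measure; $\mathsf{E}$ is the corresponding expectation. An estimator is a measurable function of $(X_1,\dots,X_n)$; its pointwise risk is $R_n(\tilde f,f)=(\mathsf{E}[\{\tilde f(t)-f(t)\}^2])^{1/2}$. For nonnegative sequences, $u_n\lesssim v_n$ means $\limsup_{n\to\infty}u_n/v_n<\infty$; $(N_n)$ is the minimax rate of convergence over $\Sigma(s,L)$ if it has the same asymptotic order as $\inf_{\tilde f}\sup_{f\in\Sigma(s,L)}R_n(\tilde f,f)$ (each $\lesssim$ the other). Hölder class. For $\alpha\in\mathbb{N}_0^2$, $|\alpha|=\alpha_1+\alpha_2$, $\varphi_\alpha(u)=u_1^{\alpha_1}u_2^{\alpha_2}$; $\mathcal{P}_m=\mathrm{Span}(\varphi_\alpha:|\alpha|\le m)$ has dimension $D_m=\binom{m+2}{2}$. For $s,L>0$, a density $f:\mathcal{D}\to\mathbb{R}$ belongs to $\Sigma(s,L)$ if there is $q\in\mathcal{P}_{\lceil s\rceil-1}$ with $|f(t+u)-q(u)|\le L\|u\|_\infty^s$ for all $u\in\mathcal{V}(\rho)$ ($\lceil s\rceil-1$ is the greatest integer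 strictly less than $s$). Local polynomial estimators. For $\gamma=(m,h)\in\mathbb{N}_0\times(0,\rho]$: $K=\mathbf{1}_\Delta$, $w_h(u)=h^{-2}K(h^{-1}u)\mathbf{1}_{\mathcal{D}}(t+u)$; $\Phi_\gamma(u)=(\varphi_\alpha(u/h))_{|\alpha|\le m}$ as a column vector of length $D_m$ (graded by $|\alpha|$, lexicographic order within each degree); $\mathcal{B}_\gamma=\int\Phi_\gamma(u)\Phi_\gamma^\top(u)w_h(u)\,du$ (symmetric positive definite); $\mathcal{B}_\gamma^{1/2}$ is the lower triangular Cholesky factor of $\mathcal{B}_\gamma$; $H_\gamma(u)=\mathcal{B}_\gamma^{-1/2}\Phi_\gamma(u)$; and $\hat f_\gamma(t)=\frac1n\sum_{i=1}^n H_\gamma^\top(0)H_\gamma(X_i-t)w_h(X_i-t)$. *)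

theory Defs
  imports "HOL-Probability.Probability" "Jordan_Normal_Form.Gauss_Jordan_Elimination"
begin

definition cusp_domain :: "real \<Rightarrow> (real \<times> real) set" where
  "cusp_domain k = {(x, y). 0 \<le> x \<and> x \<le> 1 \<and> 0 \<le> y \<and> y \<le> x powr k}"

text \<open>The sup norm on the plane is the library's \<^const>\<open>infnorm\<close>.\<close>

definition nbhd :: "(real \<times> real) set \<Rightarrow> real \<times> real \<Rightarrow> real \<Rightarrow> (real \<times> real) set" where
  "nbhd D t h = {u. t + u \<in> D \<and> infnorm u \<le> h}"

text \<open>A density is a function on \<open>D\<close>: nothing is required of the values of \<open>f\<close> outside \<open>D\<close>,
  and every notion below depends only on the restriction of \<open>f\<close> to \<open>D\<close>, as long as the
  point \<open>t\<close> at which \<open>f\<close> is estimated lies in \<open>D\<close>.\<close>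

definition density_on :: "(real \<times> real) set \<Rightarrow> (real \<times> real \<Rightarrow> real) \<Rightarrow> bool" where
  "density_on D f \<longleftrightarrow>
     f \<in> borel_measurable (restrict_space borel D) \<and> (\<forall>x\<in>D. 0 \<le> f x) \<and>
     (\<integral>\<^sup>+x\<in>D. ennreal (f x) \<partial>lborel) = 1"

definition monomial :: "nat \<times> nat \<Rightarrow> real \<times> real \<Rightarrow> real" where
  "monomial \<alpha> u = fst u ^ fst \<alpha> * snd u ^ snd \<alpha>"

definition poly_space :: "nat \<Rightarrow> (real \<times> real \<Rightarrow> real) set" where
  "poly_space m = {q. \<exists>c. q = (\<lambda>u. \<Sum>\<alpha>\<in>{\<alpha>. fst \<alpha> + snd \<alpha> \<le> m}. c \<alpha> * monomial \<alpha> u)}"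

text \<open>The greatest integer strictly less than \<open>s\<close>, for \<open>s > 0\<close>.\<close>

definition holder_degree :: "real \<Rightarrow> nat" where
  "holder_degree s = nat (\<lceil>s\<rceil> - 1)"

definition holder_class ::
    "(real \<times> real) set \<Rightarrow> real \<times> real \<Rightarrow> real \<Rightarrow> real \<Rightarrow> real \<Rightarrow> (real \<times> real \<Rightarrow> real) set" where
  "holder_class D t \<rho> s L =
     {f. density_on D f \<and>
         (\<exists>q\<in>poly_space (holder_degree s).
            \<forall>u\<in>nbhd D t \<rho>. \<bar>f (t + u) - q u\<bar> \<le> L * infnorm u powr s)}"

text \<open>The joint law of \<open>n\<close> independent observations with density \<open>f\<close> on \<open>D\<close>; the observations are
  the coordinates \<open>\<omega> 0, \<dots>, \<omega> (n - 1)\<close> of a point \<open>\<omega>\<close> of this space.\<close>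

definition sample_law ::
    "(real \<times> real) set \<Rightarrow> nat \<Rightarrow> (real \<times> real \<Rightarrow> real) \<Rightarrow> (nat \<Rightarrow> real \<times> real) measure" where
  "sample_law D n f =
     Pi\<^sub>M {..<n} (\<lambda>_. density lborel (\<lambda>x. ennreal (f x) * indicator D x))"

definition estimators :: "nat \<Rightarrow> ((nat \<Rightarrow> real \<times> real) \<Rightarrow> real) set" where
  "estimators n = borel_measurable (Pi\<^sub>M {..<n} (\<lambda>_. borel))"

definition ennreal_sqrt :: "ennreal \<Rightarrow> ennreal" where
  "ennreal_sqrt x = (if x = \<top> then \<top> else ennreal (sqrt (enn2real x)))"

text \<open>The risk is extended-valued, since an arbitrary estimator need not be square integrable.\<close>

definition risk ::
    "(real \<times> real) set \<Rightarrow> real \<times> real \<Rightarrow> nat \<Rightarrow> ((nat \<Rightarrow> real \<times> real) \<Rightarrow> real) \<Rightarrow>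
     (real \<times> real \<Rightarrow> real) \<Rightarrow> ennreal" where
  "risk D t n g f = ennreal_sqrt (\<integral>\<^sup>+\<omega>. ennreal ((g \<omega> - f t)\<^sup>2) \<partial>sample_law D n f)"

definition minimax_risk ::
    "(real \<times> real) set \<Rightarrow> real \<times> real \<Rightarrow> (real \<times> real \<Rightarrow> real) set \<Rightarrow> nat \<Rightarrow> ennreal" where
  "minimax_risk D t F n = (INF g\<in>estimators n. SUP f\<in>F. risk D t n g f)"

text \<open>In \<^typ>\<open>ennreal\<close>, a positive number divided by \<open>0\<close> is \<open>\<top>\<close>, and \<open>0 / 0 = 0\<close>.\<close>

definition asymp_le :: "(nat \<Rightarrow> ennreal) \<Rightarrow> (nat \<Rightarrow> ennreal) \<Rightarrow> bool" where
  "asymp_le u v \<longleftrightarrow> limsup (\<lambda>n. u n / v n) < \<top>"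

definition is_minimax_rate ::
    "(real \<times> real) set \<Rightarrow> real \<times> real \<Rightarrow> (real \<times> real \<Rightarrow> real) set \<Rightarrow> (nat \<Rightarrow> real) \<Rightarrow> bool" where
  "is_minimax_rate D t F N \<longleftrightarrow>
     asymp_le (\<lambda>n. ennreal (N n)) (minimax_risk D t F) \<and>
     asymp_le (minimax_risk D t F) (\<lambda>n. ennreal (N n))"

text \<open>The multi-indices of degree at most \<open>m\<close>, graded by degree and in increasing lexicographic
  order within each degree.\<close>

definition multi_indices :: "nat \<Rightarrow> (nat \<times> nat) list" where
  "multi_indices m = concat (map (\<lambda>d. map (\<lambda>i. (i, d - i)) [0..<Suc d]) [0..<Suc m])"

definition kernel_weight ::
    "(real \<times> real) set \<Rightarrow> real \<times> real \<Rightarrow> real \<Rightarrow> real \<times> real \<Rightarrow> real" where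
  "kernel_weight D t h u =
     indicator (cbox (-1, -1) (1, 1)) (inverse h *\<^sub>R u) / h\<^sup>2 * indicator D (t + u)"

definition feature_vec :: "nat \<Rightarrow> real \<Rightarrow> real \<times> real \<Rightarrow> real vec" where
  "feature_vec m h u = vec_of_list (map (\<lambda>\<alpha>. monomial \<alpha> (inverse h *\<^sub>R u)) (multi_indices m))"

definition gram_matrix ::
    "(real \<times> real) set \<Rightarrow> real \<times> real \<Rightarrow> nat \<Rightarrow> real \<Rightarrow> real mat" where
  "gram_matrix D t m h =
     mat (length (multi_indices m)) (length (multi_indices m))
       (\<lambda>(i, j). \<integral>u. vec_index (feature_vec m h u) i * vec_index (feature_vec m h u) j
                      * kernel_weight D t h u \<partial>lborel)"

definition is_cholesky_factor :: "real mat \<Rightarrow> real mat \<Rightarrow> bool" where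
  "is_cholesky_factor B G \<longleftrightarrow>
     G \<in> carrier_mat (dim_row B) (dim_row B) \<and>
     (\<forall>i<dim_row B. \<forall>j<dim_row B. i < j \<longrightarrow> G $$ (i, j) = 0) \<and>
     (\<forall>i<dim_row B. 0 < G $$ (i, i)) \<and>
     G * transpose_mat G = B"

text \<open>A symmetric positive definite matrix has exactly one such factor.\<close>

definition cholesky :: "real mat \<Rightarrow> real mat" where
  "cholesky B = (THE G. is_cholesky_factor B G)"

definition basis_vec ::
    "(real \<times> real) set \<Rightarrow> real \<times> real \<Rightarrow> nat \<Rightarrow> real \<Rightarrow> real \<times> real \<Rightarrow> real vec" where
  "basis_vec D t m h u =
     the (mat_inverse (cholesky (gram_matrix D t m h))) *\<^sub>v feature_vec m h u"

definition local_poly_est ::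
    "(real \<times> real) set \<Rightarrow> real \<times> real \<Rightarrow> nat \<Rightarrow> real \<Rightarrow> nat \<Rightarrow> (nat \<Rightarrow> real \<times> real) \<Rightarrow> real" where
  "local_poly_est D t m h n \<omega> =
     (\<Sum>i<n. scalar_prod (basis_vec D t m h 0) (basis_vec D t m h (\<omega> i - t))
              * kernel_weight D t h (\<omega> i - t)) / real n"

definition rate_exponent :: "real \<Rightarrow> real \<Rightarrow> real" where
  "rate_exponent k \<beta> =
     (\<beta> - 2 * (of_int \<lceil>\<beta>\<rceil> - 1) * (k - 1)) / (2 * \<beta> + k + 1)"

end

theory Submission
  imports Defs "Jordan_Normal_Form.Determinant"
begin

text \<open>The anisotropic dilation \<open>(x, y) \<mapsto> (h x, h\<^sup>k y)\<close> maps the cusp onto its intersection with the sup norm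
  ball of radius \<open>h \<le> 1\<close>, and it multiplies areas by \<open>h\<^sup>k\<^sup>+\<^sup>1\<close>. Under this change of variables
  the Gram matrix at bandwidth \<open>h\<close> becomes the Gram matrix of the monomials on the whole cusp, up to a
  power of \<open>h\<close> and a diagonal scaling that fixes the constant monomial (\<open>gram_matrix_dilation\<close>). The weights of the local
  polynomial estimator are therefore \<open>h powr (- (k + 1))\<close> times the dilation of one bounded kernel on the
  cusp that reproduces polynomials of degree at most \<open>m\<close> at the origin (\<open>equivalent_kernel\<close>). The Cholesky
  factor enters only through the inverse of the Gram matrix.

  \<^emph>\<open>Upper bound.\<close> On the cusp, a density of the Hoelder class differs by \<open>O(x\<^sup>s)\<close> from a polynomial,
  whose coefficients are bounded uniformly over the class because the density has total mass \<open>1\<close>. The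
  density is hence bounded, and for every \<open>\<beta> \<le> s\<close> it differs by \<open>O(x\<^sup>\<beta>)\<close> from a polynomial of degree less than \<open>\<beta>\<close>
  (\<open>holder_class_truncation\<close>). So the bias is \<open>O(h\<^sup>\<beta>)\<close> and the variance \<open>O(1 / (n h\<^sup>k\<^sup>+\<^sup>1))\<close>. The choice
  \<open>h = n powr (- 1 / (2 * \<beta> + k + 1))\<close> gives the rate \<open>n powr (- \<beta> / (2 * \<beta> + k + 1))\<close> for every
  \<open>\<beta> \<in> (0, s]\<close> (\<open>local_poly_risk_upper_bound\<close>). The rate exponent is at most
  \<open>\<beta> / (2 * \<beta> + k + 1)\<close>, with equality for \<open>\<beta> \<le> 1\<close>, so this implies the asserted bound and improves on it for \<open>\<beta> > 1\<close>.
  The maximum of the rate exponent is attained because the exponent increases between consecutive integers.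

  \<^emph>\<open>Lower bound.\<close> For \<open>s \<le> 1\<close> the class only restricts the increments from the origin, so it contains
  the uniform density and a step density that exceeds it by a constant multiple of \<open>h\<^sup>s\<close> for \<open>x \<le> h\<close>.
  The two are statistically indistinguishable from \<open>n\<close> observations when \<open>n h\<^sup>2\<^sup>s\<^sup>+\<^sup>k\<^sup>+\<^sup>1\<close> is small
  (\<open>minimax_lower_bound\<close>), and the two-point method (\<open>two_point_lower_bound\<close>) turns
  the difference of their values at the origin into a lower bound for the risk.\<close>

section \<open>Cholesky factors of positive definite matrices\<close>

text \<open>One step of Cholesky elimination: the first column of the factor is read off from the first column
  of the matrix, and what remains is the factor of the Schur complement, which is again positive definite.\<close>

lemma cholesky_exists:
  fixes A :: "nat \<Rightarrow> nat \<Rightarrow> real"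
  assumes sym: "\<And>i j. i < n \<Longrightarrow> j < n \<Longrightarrow> A i j = A j i"
    and pd: "\<And>x. \<exists>i<n. x i \<noteq> 0 \<Longrightarrow> 0 < (\<Sum>i<n. \<Sum>j<n. x i * A i j * x j)"
  shows "\<exists>G. (\<forall>i<n. 0 < G i i) \<and> (\<forall>i<n. \<forall>j<n. i < j \<longrightarrow> G i j = 0) \<and>
     (\<forall>i<n. \<forall>j<n. (\<Sum>l<n. G i l * G j l) = A i j)"
  using assms
proof (induction n arbitrary: A)
  case 0
  then show ?case by simp
next
  case (Suc n)
  have expand: "(\<Sum>i<Suc n. \<Sum>j<Suc n. x i * A i j * x j) =
      x 0 * A 0 0 * x 0 + (\<Sum>j<n. x 0 * A 0 (Suc j) * x (Suc j))
      + ((\<Sum>i<n. x (Suc i) * A (Suc i) 0 * x 0)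
      + (\<Sum>i<n. \<Sum>j<n. x (Suc i) * A (Suc i) (Suc j) * x (Suc j)))" for x
    by (simp add: sum.lessThan_Suc_shift sum.distrib del: sum.lessThan_Suc)
  have pos: "0 < A 0 0"
  proof -
    have "0 < (\<Sum>i<Suc n. \<Sum>j<Suc n. (if i = 0 then 1 else 0) * A i j * (if j = 0 then 1 else 0))"
      by (rule Suc.prems(2)) auto
    then show ?thesis by (simp add: expand del: sum.lessThan_Suc)
  qed
  \<comment> \<open>the Schur complement of the top left entry\<close>
  define S where "S i j = A (Suc i) (Suc j) - A (Suc i) 0 * A 0 (Suc j) / A 0 0" for i j
  have Ssym: "S i j = S j i" if "i < n" "j < n" for i j
    using that Suc.prems(1)[of "Suc i" "Suc j"] Suc.prems(1)[of "Suc i" 0] Suc.prems(1)[of "Suc j" 0]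
    by (simp add: S_def)
  have Spd: "0 < (\<Sum>i<n. \<Sum>j<n. x i * S i j * x j)" if x: "\<exists>i<n. x i \<noteq> 0" for x
  proof -
    define r where "r = (\<Sum>j<n. A 0 (Suc j) * x j)"
    \<comment> \<open>this choice of the first coordinate minimises the quadratic form over it, and the minimum is
      the quadratic form of the Schur complement\<close>
    define y where "y = (\<lambda>i. case i of 0 \<Rightarrow> - r / A 0 0 | Suc i \<Rightarrow> x i)"
    from x obtain i where "i < n" "x i \<noteq> 0" by blast
    then have "\<exists>i<Suc n. y i \<noteq> 0" by (intro exI[of _ "Suc i"]) (simp add: y_def)
    then have "0 < (\<Sum>i<Suc n. \<Sum>j<Suc n. y i * A i j * y j)" by (rule Suc.prems(2))
    also have "\<dots> = y 0 * A 0 0 * y 0 + y 0 * r + r * y 0 +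
        (\<Sum>i<n. \<Sum>j<n. x i * A (Suc i) (Suc j) * x j)"
    proof -
      have "(\<Sum>i<n. x i * A (Suc i) 0 * y 0) = r * y 0"
        unfolding r_def sum_distrib_right
        by (intro sum.cong) (use Suc.prems(1) in \<open>auto simp: mult_ac\<close>)
      moreover have "(\<Sum>j<n. y 0 * A 0 (Suc j) * x j) = y 0 * r"
        unfolding r_def sum_distrib_left by (simp add: mult_ac)
      moreover have "y (Suc i) = x i" for i by (simp add: y_def)
      ultimately show ?thesis unfolding expand by simp
    qed
    also have "\<dots> = (\<Sum>i<n. \<Sum>j<n. x i * A (Suc i) (Suc j) * x j) - r * r / A 0 0"
      using pos by (simp add: y_def field_simps)
    also have "r * r = (\<Sum>i<n. \<Sum>j<n. x i * (A (Suc i) 0 * A 0 (Suc j)) * x j)"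
      unfolding r_def sum_product
      by (intro sum.cong) (use Suc.prems(1) in \<open>auto simp: mult_ac\<close>)
    finally show ?thesis
      by (simp add: S_def sum_subtractf sum_divide_distrib algebra_simps)
  qed
  from Suc.IH[OF Ssym Spd] obtain G where G: "\<forall>i<n. 0 < G i i"
    "\<forall>i<n. \<forall>j<n. i < j \<longrightarrow> G i j = 0" "\<forall>i<n. \<forall>j<n. (\<Sum>l<n. G i l * G j l) = S i j"
    by blast
  define H where "H i j = (case j of 0 \<Rightarrow> A i 0 / sqrt (A 0 0)
     | Suc j' \<Rightarrow> (case i of 0 \<Rightarrow> 0 | Suc i' \<Rightarrow> G i' j'))" for i j
  have sqrtA: "sqrt (A 0 0) * sqrt (A 0 0) = A 0 0" "sqrt (A 0 0) > 0" using pos by auto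
  have "\<forall>i<Suc n. 0 < H i i"
    using G(1) pos by (auto simp: H_def split: nat.split)
  moreover have "\<forall>i<Suc n. \<forall>j<Suc n. i < j \<longrightarrow> H i j = 0"
    using G(2) by (auto simp: H_def split: nat.split)
  moreover have "(\<Sum>l<Suc n. H i l * H j l) = A i j" if ij: "i < Suc n" "j < Suc n" for i j
  proof -
    have eq: "(\<Sum>l<Suc n. H i l * H j l) = A i 0 * A j 0 / A 0 0 + (\<Sum>l<n. H i (Suc l) * H j (Suc l))"
      using sqrtA by (simp add: sum.lessThan_Suc_shift H_def del: sum.lessThan_Suc)
    show ?thesis
    proof (cases "i = 0 \<or> j = 0")
      case True
      then have "(\<Sum>l<n. H i (Suc l) * H j (Suc l)) = 0" by (intro sum.neutral) (auto simp: H_def)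
      then show ?thesis using True pos eq Suc.prems(1)[OF ij] by auto
    next
      case False
      then obtain i' j' where [simp]: "i = Suc i'" "j = Suc j'" by (meson not0_implies_Suc)
      have "(\<Sum>l<n. H i (Suc l) * H j (Suc l)) = S i' j'"
        using G(3) ij by (simp add: H_def)
      then show ?thesis unfolding eq using Suc.prems(1)[of 0 j] ij by (simp add: S_def)
    qed
  qed
  ultimately show ?case by blast
qed

text \<open>The columns are determined one after the other: column \<open>j\<close> of \<open>G G\<^sup>T\<close> involves only the
  columns of \<open>G\<close> up to \<open>j\<close>, since \<open>G\<close> is lower triangular.\<close>

lemma cholesky_unique:
  fixes G F :: "nat \<Rightarrow> nat \<Rightarrow> real"
  assumes G: "\<And>i. i < n \<Longrightarrow> 0 < G i i" "\<And>i j. j < n \<Longrightarrow> i < j \<Longrightarrow> G i j = 0"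
    and F: "\<And>i. i < n \<Longrightarrow> 0 < F i i" "\<And>i j. j < n \<Longrightarrow> i < j \<Longrightarrow> F i j = 0"
    and eq: "\<And>i j. i < n \<Longrightarrow> j < n \<Longrightarrow> (\<Sum>l<n. G i l * G j l) = (\<Sum>l<n. F i l * F j l)"
  shows "i < n \<Longrightarrow> j < n \<Longrightarrow> G i j = F i j"
proof (induction j arbitrary: i rule: less_induct)
  case (less j)
  have upto: "(\<Sum>l<n. H i l * H j l) = (\<Sum>l<j. H i l * H j l) + H i j * H j j"
    if "\<And>i j. j < n \<Longrightarrow> i < j \<Longrightarrow> H i j = 0" for H :: "nat \<Rightarrow> nat \<Rightarrow> real" and i
  proof -
    have "(\<Sum>l<n. H i l * H j l) = (\<Sum>l<Suc j. H i l * H j l)"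
      using less.prems(2) that by (intro sum.mono_neutral_right) (auto simp: not_less)
    then show ?thesis by simp
  qed
  have diff: "G i j * G j j = F i j * F j j" if "i < n" for i
  proof -
    have "(\<Sum>l<j. G i l * G j l) = (\<Sum>l<j. F i l * F j l)"
      using less that by (intro sum.cong) auto
    then show ?thesis using eq[OF that less.prems(2)] upto[of G i, OF G(2)] upto[of F i, OF F(2)] by simp
  qed
  have "G j j = F j j"
    using diff[OF less.prems(2)] G(1)[OF less.prems(2)] F(1)[OF less.prems(2)]
    by (intro power2_eq_imp_eq[of "G j j" "F j j"]) (auto simp: power2_eq_square less_imp_le)
  then show ?case using diff[OF less.prems(1)] G(1)[OF less.prems(2)] by simp
qed

lemma is_cholesky_factor_cholesky:
  assumes B: "B \<in> carrier_mat n n"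
    and sym: "\<And>i j. i < n \<Longrightarrow> j < n \<Longrightarrow> B $$ (i, j) = B $$ (j, i)"
    and pd: "\<And>x. \<exists>i<n. x i \<noteq> 0 \<Longrightarrow> 0 < (\<Sum>i<n. \<Sum>j<n. x i * B $$ (i, j) * x j)"
  shows "is_cholesky_factor B (cholesky B)"
proof -
  have prod: "(G * transpose_mat G) $$ (i, j) = (\<Sum>l<n. G $$ (i, l) * G $$ (j, l))"
    if "G \<in> carrier_mat n n" "i < n" "j < n" for G :: "real mat" and i j
    using that by (simp add: scalar_prod_def lessThan_atLeast0)
  from cholesky_exists[of n "\<lambda>i j. B $$ (i, j)"] sym pd
  obtain G where G: "\<forall>i<n. 0 < G i i" "\<forall>i<n. \<forall>j<n. i < j \<longrightarrow> G i j = 0"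
    "\<forall>i<n. \<forall>j<n. (\<Sum>l<n. G i l * G j l) = B $$ (i, j)"
    by blast
  have "is_cholesky_factor B (mat n n (\<lambda>(i, j). G i j))"
    unfolding is_cholesky_factor_def
  proof (intro conjI)
    show "mat n n (\<lambda>(i, j). G i j) * transpose_mat (mat n n (\<lambda>(i, j). G i j)) = B"
      using B G(3) by (intro eq_matI) (auto simp: scalar_prod_def lessThan_atLeast0)
  qed (use B G in auto)
  then show ?thesis
    unfolding cholesky_def
  proof (rule theI)
    fix F assume F: "is_cholesky_factor B F"
    let ?G = "mat n n (\<lambda>(i, j). G i j)"
    have Fc: "F \<in> carrier_mat n n" using F B by (auto simp: is_cholesky_factor_def)
    have "F $$ (i, j) = ?G $$ (i, j)" if "i < n" "j < n" for i j
    proof (rule cholesky_unique[of n "\<lambda>i j. F $$ (i, j)" "\<lambda>i j. ?G $$ (i, j)" i j])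
      fix i j assume "i < n" "j < n"
      then show "(\<Sum>l<n. F $$ (i, l) * F $$ (j, l)) = (\<Sum>l<n. ?G $$ (i, l) * ?G $$ (j, l))"
        using F G(3) prod[OF Fc] by (simp add: is_cholesky_factor_def)
    qed (use F B G that in \<open>auto simp: is_cholesky_factor_def\<close>)
    then show "F = ?G" using Fc by (intro eq_matI) auto
  qed
qed

text \<open>If \<open>M\<close> inverts the Cholesky factor of \<open>B\<close>, then \<open>M\<^sup>T M\<close> inverts \<open>B\<close>.\<close>

lemma cholesky_inverse:
  assumes B: "B \<in> carrier_mat n n"
    and sym: "\<And>i j. i < n \<Longrightarrow> j < n \<Longrightarrow> B $$ (i, j) = B $$ (j, i)"
    and pd: "\<And>x. \<exists>i<n. x i \<noteq> 0 \<Longrightarrow> 0 < (\<Sum>i<n. \<Sum>j<n. x i * B $$ (i, j) * x j)"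
  obtains M where "mat_inverse (cholesky B) = Some M" "M \<in> carrier_mat n n"
    "B * (transpose_mat M * M) = 1\<^sub>m n"
proof -
  define G where "G = cholesky B"
  have G: "G \<in> carrier_mat n n" "\<And>i j. i < j \<Longrightarrow> j < n \<Longrightarrow> G $$ (i, j) = 0"
    "\<And>i. i < n \<Longrightarrow> 0 < G $$ (i, i)" "G * transpose_mat G = B"
    using is_cholesky_factor_cholesky[OF assms] B by (auto simp: is_cholesky_factor_def G_def)
  have "det G = (\<Prod>i<n. G $$ (i, i))"
    using det_lower_triangular[OF G(2) G(1)] G(1) by (simp add: prod_list_diag_prod lessThan_atLeast0)
  then have "det G \<noteq> 0" using G(3) by (auto simp: less_le)
  from det_non_zero_imp_unit[OF G(1) this] mat_inverse(1)[OF G(1)]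
  obtain M where M: "mat_inverse G = Some M" by fastforce
  from mat_inverse(2)[OF G(1) M] have GM: "G * M = 1\<^sub>m n" "M * G = 1\<^sub>m n" "M \<in> carrier_mat n n" by auto
  have "transpose_mat G * transpose_mat M = 1\<^sub>m n"
    using transpose_mult[OF GM(3) G(1)] GM(2) by simp
  then have "transpose_mat G * (transpose_mat M * M) = M"
    using assoc_mult_mat[of "transpose_mat G" n n "transpose_mat M" n M n] G(1) GM(3) by simp
  then have 1: "G * (transpose_mat G * (transpose_mat M * M)) = 1\<^sub>m n"
    using GM(1) by simp
  have "G * transpose_mat G * (transpose_mat M * M) = G * (transpose_mat G * (transpose_mat M * M))"
    by (rule assoc_mult_mat[of _ n n _ n _ n]) (use G(1) GM(3) in auto)
  then have "B * (transpose_mat M * M) = 1\<^sub>m n"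
    using 1 G(4) by simp
  then show ?thesis
    using M GM(3) by (intro that) (simp_all add: G_def)
qed

section \<open>Sample means and two-point lower bounds\<close>

text \<open>The decomposition into variance and squared bias, with the variance bounded by the second moment.\<close>

lemma sample_mean_sq_error:
  fixes K :: "'a \<Rightarrow> real"
  assumes "prob_space N" and K[measurable]: "K \<in> borel_measurable N"
    and bnd: "\<And>x. x \<in> space N \<Longrightarrow> \<bar>K x\<bar> \<le> c" and n: "n \<ge> 1"
  shows "(\<integral>\<^sup>+\<omega>. ennreal (((\<Sum>i<n. K (\<omega> i)) / real n - \<theta>)\<^sup>2) \<partial>Pi\<^sub>M {..<n} (\<lambda>_. N))
    \<le> ennreal ((\<integral>x. (K x)\<^sup>2 \<partial>N) / real n + ((\<integral>x. K x \<partial>N) - \<theta>)\<^sup>2)"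
proof -
  interpret prob_space N by fact
  interpret product_sigma_finite "\<lambda>_::nat. N" by standard
  define Z where "Z x = K x - \<theta>" for x
  have [measurable]: "Z \<in> borel_measurable N" unfolding Z_def by measurable
  have iK: "integrable N K" by (rule integrable_const_bound[where B=c]) (use bnd in auto)
  have iK2: "integrable N (\<lambda>x. (K x)\<^sup>2)"
  proof (rule integrable_const_bound[where B="c\<^sup>2"])
    show "AE x in N. norm ((K x)\<^sup>2) \<le> c\<^sup>2"
      using bnd by (intro AE_I2) (metis abs_le_square_iff abs_of_nonneg abs_ge_zero order_trans power2_abs real_norm_def zero_le_power2)
  qed auto
  have iZ: "integrable N Z" unfolding Z_def using iK by auto
  have Z2: "(\<lambda>x. Z x * Z x) = (\<lambda>x. (K x)\<^sup>2 - 2 * \<theta> * K x + \<theta>\<^sup>2)"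
    by (auto simp: Z_def fun_eq_iff power2_eq_square algebra_simps)
  have iZ2: "integrable N (\<lambda>x. Z x * Z x)" unfolding Z2 using iK iK2 by auto
  define \<mu> where "\<mu> = (\<integral>x. K x \<partial>N)"
  have EZ: "(\<integral>x. Z x \<partial>N) = \<mu> - \<theta>" unfolding Z_def \<mu>_def using iK by (simp add: prob_space)
  have EZ2: "(\<integral>x. Z x * Z x \<partial>N) = (\<integral>x. (K x)\<^sup>2 \<partial>N) - 2 * \<theta> * \<mu> + \<theta>\<^sup>2"
    unfolding Z2 \<mu>_def using iK iK2 by (simp add: prob_space)
  have cross: "integrable (Pi\<^sub>M {..<n} (\<lambda>_. N)) (\<lambda>\<omega>. Z (\<omega> i) * Z (\<omega> j)) \<and>
      (\<integral>\<omega>. Z (\<omega> i) * Z (\<omega> j) \<partial>Pi\<^sub>M {..<n} (\<lambda>_. N))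
      = (if i = j then (\<integral>x. Z x * Z x \<partial>N) else (\<mu> - \<theta>)\<^sup>2)" if ij: "i < n" "j < n" for i j
  proof -
    \<comment> \<open>\<open>Z (\<omega> i) * Z (\<omega> j)\<close> as a product over all coordinates, to which Fubini applies; the
      diagonal case \<open>i = j\<close> is included\<close>
    define F where "F l x = (if l = i then Z x else 1) * (if l = j then Z x else 1)" for l x
    have iF: "integrable N (F l)" for l
      using iZ iZ2 by (cases "l = i"; cases "l = j") (auto simp: F_def[abs_def])
    have eq: "(\<Prod>l<n. F l (\<omega> l)) = Z (\<omega> i) * Z (\<omega> j)" for \<omega>
      using ij unfolding F_def by (simp add: prod.distrib)
    have "(\<Prod>l<n. integral\<^sup>L N (F l)) = (if i = j then (\<integral>x. Z x * Z x \<partial>N) else (\<mu> - \<theta>)\<^sup>2)"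
    proof (cases "i = j")
      case True
      have "integral\<^sup>L N (F l) = (if l = i then (\<integral>x. Z x * Z x \<partial>N) else 1)" for l
        using True by (auto simp: F_def[abs_def] prob_space)
      then show ?thesis using True ij by simp
    next
      case False
      have "integral\<^sup>L N (F l) = (if l = i then \<mu> - \<theta> else 1) * (if l = j then \<mu> - \<theta> else 1)" for l
        using False EZ by (auto simp: F_def[abs_def] prob_space)
      then show ?thesis using False ij by (simp add: prod.distrib power2_eq_square)
    qed
    then show ?thesis
      using product_integral_prod[of "{..<n}" F] product_integrable_prod[of "{..<n}" F] iF
      by (simp add: eq)
  qed
  note cross_int = cross[THEN conjunct1]
  have sq: "((\<Sum>i<n. K (\<omega> i)) / real n - \<theta>)\<^sup>2 = (\<Sum>i<n. \<Sum>j<n. Z (\<omega> i) * Z (\<omega> j)) / (real n)\<^sup>2" for \<omega>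
  proof -
    have "(\<Sum>i<n. K (\<omega> i)) / real n - \<theta> = (\<Sum>i<n. Z (\<omega> i)) / real n"
      using n by (simp add: Z_def sum_subtractf field_simps)
    then show ?thesis by (simp add: power_divide power2_eq_square sum_product)
  qed
  have int: "integrable (Pi\<^sub>M {..<n} (\<lambda>_. N)) (\<lambda>\<omega>. ((\<Sum>i<n. K (\<omega> i)) / real n - \<theta>)\<^sup>2)"
    unfolding sq using cross_int by (intro integrable_divide Bochner_Integration.integrable_sum) auto
  have "(\<integral>\<omega>. ((\<Sum>i<n. K (\<omega> i)) / real n - \<theta>)\<^sup>2 \<partial>Pi\<^sub>M {..<n} (\<lambda>_. N))
     = (\<Sum>i<n. \<Sum>j<n. \<integral>\<omega>. Z (\<omega> i) * Z (\<omega> j) \<partial>Pi\<^sub>M {..<n} (\<lambda>_. N)) / (real n)\<^sup>2"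
  proof -
    have "(\<integral>\<omega>. (\<Sum>i<n. \<Sum>j<n. Z (\<omega> i) * Z (\<omega> j)) \<partial>Pi\<^sub>M {..<n} (\<lambda>_. N))
        = (\<Sum>i<n. \<integral>\<omega>. (\<Sum>j<n. Z (\<omega> i) * Z (\<omega> j)) \<partial>Pi\<^sub>M {..<n} (\<lambda>_. N))"
      by (intro Bochner_Integration.integral_sum Bochner_Integration.integrable_sum cross_int) auto
    also have "\<dots> = (\<Sum>i<n. \<Sum>j<n. \<integral>\<omega>. Z (\<omega> i) * Z (\<omega> j) \<partial>Pi\<^sub>M {..<n} (\<lambda>_. N))"
      by (intro sum.cong refl Bochner_Integration.integral_sum cross_int) auto
    finally show ?thesis unfolding sq by simp
  qed
  also have "(\<Sum>i<n. \<Sum>j<n. \<integral>\<omega>. Z (\<omega> i) * Z (\<omega> j) \<partial>Pi\<^sub>M {..<n} (\<lambda>_. N))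
     = (\<Sum>i<n. \<Sum>j<n. (\<mu> - \<theta>)\<^sup>2 + (if i = j then (\<integral>x. Z x * Z x \<partial>N) - (\<mu> - \<theta>)\<^sup>2 else 0))"
    by (intro sum.cong refl) (simp add: cross[THEN conjunct2])
  also have "\<dots> = real n * (real n * (\<mu> - \<theta>)\<^sup>2 + ((\<integral>x. Z x * Z x \<partial>N) - (\<mu> - \<theta>)\<^sup>2))"
    by (simp add: sum.distrib algebra_simps)
  also have "\<dots> / (real n)\<^sup>2 = (\<mu> - \<theta>)\<^sup>2 + ((\<integral>x. Z x * Z x \<partial>N) - (\<mu> - \<theta>)\<^sup>2) / real n"
    using n by (simp add: field_simps power2_eq_square)
  also have "(\<integral>x. Z x * Z x \<partial>N) - (\<mu> - \<theta>)\<^sup>2 = (\<integral>x. (K x)\<^sup>2 \<partial>N) - \<mu>\<^sup>2"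
    unfolding EZ2 by (simp add: power2_eq_square algebra_simps)
  also have "(\<mu> - \<theta>)\<^sup>2 + ((\<integral>x. (K x)\<^sup>2 \<partial>N) - \<mu>\<^sup>2) / real n \<le> (\<integral>x. (K x)\<^sup>2 \<partial>N) / real n + (\<mu> - \<theta>)\<^sup>2"
    by (simp add: divide_right_mono)
  finally show ?thesis
    using int by (subst nn_integral_eq_integral) (auto simp: \<mu>_def simp del: ennreal_plus intro!: ennreal_leI)
qed

lemma PiM_density:
  fixes r :: "'a \<Rightarrow> ennreal"
  assumes "finite I" "sigma_finite_measure N" and r[measurable]: "r \<in> borel_measurable N"
    and "sigma_finite_measure (density N r)"
  shows "Pi\<^sub>M I (\<lambda>_. density N r) = density (Pi\<^sub>M I (\<lambda>_. N)) (\<lambda>\<omega>. \<Prod>i\<in>I. r (\<omega> i))"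
proof -
  interpret N: product_sigma_finite "\<lambda>_. N" using assms by (simp add: product_sigma_finite_def)
  interpret R: product_sigma_finite "\<lambda>_. density N r" using assms by (simp add: product_sigma_finite_def)
  have "density (Pi\<^sub>M I (\<lambda>_. N)) (\<lambda>\<omega>. \<Prod>i\<in>I. r (\<omega> i)) = Pi\<^sub>M I (\<lambda>_. density N r)"
  proof (rule R.PiM_eqI)
    show "sets (density (Pi\<^sub>M I (\<lambda>_. N)) (\<lambda>\<omega>. \<Prod>i\<in>I. r (\<omega> i))) = sets (Pi\<^sub>M I (\<lambda>_. density N r))"
      by (simp cong: sets_PiM_cong)
    fix A assume A: "\<And>i. i \<in> I \<Longrightarrow> A i \<in> sets (density N r)"
    then have A'[measurable]: "\<And>i. i \<in> I \<Longrightarrow> A i \<in> sets N" by simp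
    have "emeasure (density (Pi\<^sub>M I (\<lambda>_. N)) (\<lambda>\<omega>. \<Prod>i\<in>I. r (\<omega> i))) (Pi\<^sub>E I A)
       = (\<integral>\<^sup>+\<omega>. (\<Prod>i\<in>I. r (\<omega> i)) * indicator (Pi\<^sub>E I A) \<omega> \<partial>Pi\<^sub>M I (\<lambda>_. N))"
      using assms(1) A' by (intro emeasure_density sets_PiM_I_finite) auto
    also have "\<dots> = (\<integral>\<^sup>+\<omega>. (\<Prod>i\<in>I. r (\<omega> i) * indicator (A i) (\<omega> i)) \<partial>Pi\<^sub>M I (\<lambda>_. N))"
    proof (intro nn_integral_cong)
      fix \<omega> assume "\<omega> \<in> space (Pi\<^sub>M I (\<lambda>_. N))"
      then have "\<omega> \<in> extensional I" by (auto simp: space_PiM PiE_def)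
      then have "(indicator (Pi\<^sub>E I A) \<omega> :: ennreal) = (\<Prod>i\<in>I. indicator (A i) (\<omega> i))"
        using assms(1) by (induction rule: infinite_finite_induct)
          (auto simp: PiE_def Pi_def indicator_def prod_zero_iff)
      then show "(\<Prod>i\<in>I. r (\<omega> i)) * indicator (Pi\<^sub>E I A) \<omega> = (\<Prod>i\<in>I. r (\<omega> i) * indicator (A i) (\<omega> i))"
        by (simp add: prod.distrib)
    qed
    also have "\<dots> = (\<Prod>i\<in>I. \<integral>\<^sup>+x. r x * indicator (A i) x \<partial>N)"
      using assms(1) A' by (intro N.product_nn_integral_prod) auto
    also have "\<dots> = (\<Prod>i\<in>I. emeasure (density N r) (A i))"
      using A' by (intro prod.cong) (auto simp: emeasure_density)
    finally show "emeasure (density (Pi\<^sub>M I (\<lambda>_. N)) (\<lambda>\<omega>. \<Prod>i\<in>I. r (\<omega> i))) (Pi\<^sub>E I A)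
       = (\<Prod>i\<in>I. emeasure (density N r) (A i))" .
  qed fact
  then show ?thesis by simp
qed

text \<open>Le Cam's two-point argument, with the second moment of the likelihood ratio \<open>r\<close> in place of the
  total variation distance. An estimate that is usually close to \<open>a\<close> under \<open>P\<close> errs with small
  \<open>P\<close>-probability; by the second moment bound it is then also close to \<open>a\<close>, hence far from \<open>b\<close>,
  with probability bounded below under \<open>r P\<close>.\<close>

lemma two_point_lower_bound:
  fixes r g :: "'a \<Rightarrow> real"
  assumes "prob_space P" and [measurable]: "r \<in> borel_measurable P" "g \<in> borel_measurable P"
    and r0: "\<And>x. 0 \<le> r x" and "prob_space (density P r)"
    and r2: "(\<integral>\<^sup>+x. ennreal ((r x)\<^sup>2) \<partial>P) \<le> ennreal K" and K: "K \<ge> 1"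
  shows "ennreal ((a - b)\<^sup>2 / (16 * K)) \<le> (\<integral>\<^sup>+x. ennreal ((g x - a)\<^sup>2) \<partial>P) \<or>
    ennreal ((a - b)\<^sup>2 / (16 * K)) \<le> (\<integral>\<^sup>+x. ennreal ((g x - b)\<^sup>2) \<partial>density P r)"
proof -
  interpret P: prob_space P by fact
  interpret Q: prob_space "density P r" by fact
  define \<delta> where "\<delta> = \<bar>a - b\<bar>"
  define A where "A = {x\<in>space P. \<delta> / 2 \<le> \<bar>g x - a\<bar>}"
  have A[measurable]: "A \<in> sets P" unfolding A_def by measurable
  have mk: "ennreal (\<delta>\<^sup>2 / 4 * measure M B) \<le> (\<integral>\<^sup>+x. ennreal ((g x - t)\<^sup>2) \<partial>M)"
    if "prob_space M" "B \<in> sets M" "\<And>x. x \<in> B \<Longrightarrow> \<delta> / 2 \<le> \<bar>g x - t\<bar>" for B t M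
  proof -
    interpret M: prob_space M by fact
    have "(\<integral>\<^sup>+x. ennreal (\<delta>\<^sup>2 / 4) * indicator B x \<partial>M) \<le> (\<integral>\<^sup>+x. ennreal ((g x - t)\<^sup>2) \<partial>M)"
    proof (intro nn_integral_mono)
      fix x
      have "(\<delta> / 2)\<^sup>2 \<le> (g x - t)\<^sup>2" if "x \<in> B"
        using \<open>\<And>x. x \<in> B \<Longrightarrow> \<delta> / 2 \<le> \<bar>g x - t\<bar>\<close>[OF that]
        by (metis \<delta>_def abs_ge_zero abs_le_square_iff abs_of_nonneg half_gt_zero_iff less_eq_real_def order_trans zero_less_divide_iff divide_nonneg_nonneg zero_le_numeral)
      then show "ennreal (\<delta>\<^sup>2 / 4) * indicator B x \<le> ennreal ((g x - t)\<^sup>2)"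
        by (auto simp: indicator_def power_divide intro!: ennreal_leI)
    qed
    then show ?thesis
      using that(2) by (simp add: nn_integral_cmult_indicator M.emeasure_eq_measure ennreal_mult[symmetric])
  qed
  have thr: "(a - b)\<^sup>2 / (16 * K) \<le> \<delta>\<^sup>2 / 4 * p" if "1 / (4 * K) \<le> p" for p
  proof -
    have "\<delta>\<^sup>2 / 4 * (1 / (4 * K)) \<le> \<delta>\<^sup>2 / 4 * p" using that by (intro mult_left_mono) auto
    then show ?thesis by (simp add: \<delta>_def)
  qed
  show ?thesis
  proof (cases "1 / (4 * K) \<le> measure P A")
    case True
    have "ennreal (\<delta>\<^sup>2 / 4 * measure P A) \<le> (\<integral>\<^sup>+x. ennreal ((g x - a)\<^sup>2) \<partial>P)"
      by (rule mk) (auto simp: A_def P.prob_space_axioms)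
    then show ?thesis using thr[OF True] by (meson ennreal_leI order_trans)
  next
    case False
    have "emeasure (density P r) A = (\<integral>\<^sup>+x. ennreal (r x) * indicator A x \<partial>P)"
      by (intro emeasure_density) auto
    \<comment> \<open>the inequality of arithmetic and geometric means replaces the Cauchy-Schwarz inequality\<close>
    also have "\<dots> \<le> (\<integral>\<^sup>+x. ennreal (1 / (2 * K)) * ennreal ((r x)\<^sup>2) + ennreal (K / 2) * indicator A x \<partial>P)"
    proof (intro nn_integral_mono)
      fix x
      have "0 \<le> (r x - K)\<^sup>2" by simp
      then have "r x * (2 * K) \<le> (r x)\<^sup>2 + K * K" by (simp add: power2_eq_square algebra_simps)
      then have "r x \<le> 1 / (2 * K) * (r x)\<^sup>2 + K / 2" using K by (simp add: field_simps)
      then show "ennreal (r x) * indicator A x \<le> ennreal (1 / (2 * K)) * ennreal ((r x)\<^sup>2) + ennreal (K / 2) * indicator A x"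
        using K by (auto simp: indicator_def ennreal_mult[symmetric] ennreal_plus[symmetric] simp del: ennreal_plus intro!: ennreal_leI)
    qed
    also have "\<dots> = ennreal (1 / (2 * K)) * (\<integral>\<^sup>+x. ennreal ((r x)\<^sup>2) \<partial>P) + ennreal (K / 2) * emeasure P A"
      by (subst nn_integral_add) (auto simp: nn_integral_cmult nn_integral_cmult_indicator)
    also have "\<dots> \<le> ennreal (1 / (2 * K)) * ennreal K + ennreal (K / 2) * ennreal (1 / (4 * K))"
      using r2 False unfolding P.emeasure_eq_measure by (intro add_mono mult_left_mono ennreal_leI) auto
    also have "\<dots> = ennreal (1 / (2 * K) * K + K / 2 * (1 / (4 * K)))"
    proof -
      have gen: "ennreal p * ennreal x + ennreal q * ennreal w = ennreal (p * x + q * w)"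
        if "0 \<le> p" "0 \<le> x" "0 \<le> q" "0 \<le> w" for p x q w
        using that by (simp add: ennreal_mult)
      show ?thesis using K by (intro gen) auto
    qed
    also have "1 / (2 * K) * K + K / 2 * (1 / (4 * K)) = 5 / 8"
      using K by (simp add: field_simps)
    finally have "measure (density P r) A \<le> 5 / 8" by (simp add: Q.emeasure_eq_measure)
    moreover have "1 / (4 * K) \<le> 1 / 4" using K by (simp add: field_simps)
    ultimately have "1 / (4 * K) \<le> measure (density P r) (space (density P r) - A)"
      using Q.prob_compl[of A] by simp
    moreover have "ennreal (\<delta>\<^sup>2 / 4 * measure (density P r) (space (density P r) - A))
        \<le> (\<integral>\<^sup>+x. ennreal ((g x - b)\<^sup>2) \<partial>density P r)"
    proof (rule mk)
      fix x assume "x \<in> space (density P r) - A"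
      then have "\<bar>g x - a\<bar> < \<delta> / 2" by (auto simp: A_def)
      then show "\<delta> / 2 \<le> \<bar>g x - b\<bar>" 
        using abs_triangle_ineq4[of "g x - b" "g x - a"] by (simp add: \<delta>_def)
    qed (auto simp: Q.prob_space_axioms)
    ultimately show ?thesis using thr by (meson ennreal_leI order_trans)
  qed
qed

text \<open>The second moment of the likelihood ratio of \<open>n\<close> observations is the \<open>n\<close>-th power of that of one
  observation, hence at most \<open>exp 1 \<le> 3\<close> if the chi-square divergence \<open>v\<close> is at most \<open>1 / n\<close>.\<close>

lemma two_point_sample_lower_bound:
  fixes \<rho> :: "'a \<Rightarrow> real" and g :: "(nat \<Rightarrow> 'a) \<Rightarrow> real"
  assumes "prob_space N" and \<rho>[measurable]: "\<rho> \<in> borel_measurable N"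
    and g: "g \<in> borel_measurable (Pi\<^sub>M {..<n} (\<lambda>_. N))"
    and \<rho>0: "\<And>x. 0 \<le> \<rho> x" and "prob_space (density N \<rho>)"
    and \<rho>2: "(\<integral>\<^sup>+x. ennreal ((\<rho> x)\<^sup>2) \<partial>N) \<le> ennreal (1 + v)" and v: "0 \<le> v" "real n * v \<le> 1"
  shows "ennreal ((a - b)\<^sup>2 / 48) \<le> (\<integral>\<^sup>+\<omega>. ennreal ((g \<omega> - a)\<^sup>2) \<partial>Pi\<^sub>M {..<n} (\<lambda>_. N)) \<or>
    ennreal ((a - b)\<^sup>2 / 48) \<le> (\<integral>\<^sup>+\<omega>. ennreal ((g \<omega> - b)\<^sup>2) \<partial>Pi\<^sub>M {..<n} (\<lambda>_. density N \<rho>))"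
proof -
  interpret N: prob_space N by fact
  interpret Q: prob_space "density N \<rho>" by fact
  interpret product_sigma_finite "\<lambda>_::nat. N" by standard
  define r where "r \<omega> = (\<Prod>i<n. \<rho> (\<omega> i))" for \<omega>
  have eq: "Pi\<^sub>M {..<n} (\<lambda>_. density N \<rho>) = density (Pi\<^sub>M {..<n} (\<lambda>_. N)) r"
    using PiM_density[of "{..<n}" N "\<lambda>x. ennreal (\<rho> x)"] N.sigma_finite_measure_axioms Q.sigma_finite_measure_axioms
    by (simp add: r_def[abs_def] prod_ennreal \<rho>0)
  have "(\<integral>\<^sup>+\<omega>. ennreal ((r \<omega>)\<^sup>2) \<partial>Pi\<^sub>M {..<n} (\<lambda>_. N))
      = (\<integral>\<^sup>+\<omega>. (\<Prod>i<n. ennreal ((\<rho> (\<omega> i))\<^sup>2)) \<partial>Pi\<^sub>M {..<n} (\<lambda>_. N))"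
    by (simp add: r_def prod_ennreal prod_power_distrib)
  also have "\<dots> = (\<integral>\<^sup>+x. ennreal ((\<rho> x)\<^sup>2) \<partial>N) ^ n"
    by (subst product_nn_integral_prod) auto
  also have "\<dots> \<le> ennreal (1 + v) ^ n" using \<rho>2 by (intro power_mono) auto
  also have "\<dots> = ennreal ((1 + v) ^ n)" using v by (simp add: ennreal_power del: ennreal_plus)
  also have "\<dots> \<le> ennreal 3"
  proof (intro ennreal_leI)
    have "(1 + v) ^ n \<le> exp v ^ n" using v by (intro power_mono exp_ge_add_one_self) auto
    also have "\<dots> = exp (real n * v)" by (simp add: exp_of_nat_mult)
    also have "\<dots> \<le> exp 1" using v by simp
    finally show "(1 + v) ^ n \<le> 3" using exp_le by simp
  qed
  finally have r2: "(\<integral>\<^sup>+\<omega>. ennreal ((r \<omega>)\<^sup>2) \<partial>Pi\<^sub>M {..<n} (\<lambda>_. N)) \<le> ennreal 3" .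
  have [measurable]: "r \<in> borel_measurable (Pi\<^sub>M {..<n} (\<lambda>_. N))" unfolding r_def[abs_def] by measurable
  have "prob_space (Pi\<^sub>M {..<n} (\<lambda>_. density N \<rho>))" by (intro prob_space_PiM assms)
  then show ?thesis
    using two_point_lower_bound[of "Pi\<^sub>M {..<n} (\<lambda>_. N)" r g 3 a b] g r2
    by (simp add: eq prob_space_PiM[OF assms(1)] r_def prod_nonneg \<rho>0)
qed

lemma ennreal_sqrt_ennreal: "0 \<le> x \<Longrightarrow> ennreal_sqrt (ennreal x) = ennreal (sqrt x)"
  by (simp add: ennreal_sqrt_def)

lemma ennreal_sqrt_mono: "x \<le> y \<Longrightarrow> ennreal_sqrt x \<le> ennreal_sqrt y"
  by (cases x; cases y) (auto simp: ennreal_sqrt_def top_unique intro!: ennreal_leI)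

section \<open>The cusp and its dilations\<close>

text \<open>The standing assumption on the exponent of the cusp.\<close>

locale cusp =
  fixes k :: real
  assumes k_gt_1: "1 < k"
begin

abbreviation D :: "(real \<times> real) set" where
  "D \<equiv> cusp_domain k"

text \<open>The anisotropic dilation adapted to the cusp: for \<open>0 < h \<le> 1\<close> it maps the cusp onto its part with \<open>x \<le> h\<close>.\<close>

definition dilation :: "real \<Rightarrow> real \<times> real \<Rightarrow> real \<times> real" where
  "dilation h u = (h * fst u, h powr k * snd u)"

lemma cusp_domain_memD:
  assumes "u \<in> D"
  shows "0 \<le> fst u" "fst u \<le> 1" "0 \<le> snd u" "snd u \<le> fst u"
proof -
  have "fst u powr k \<le> fst u" if "0 \<le> fst u" "fst u \<le> 1"
    using that k_gt_1 powr_mono'[of 1 k "fst u"] by simp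
  then show "0 \<le> fst u" "fst u \<le> 1" "0 \<le> snd u" "snd u \<le> fst u"
    using assms by (auto simp: cusp_domain_def)
qed

lemma zero_in_cusp_domain: "(0, 0) \<in> D"
  by (simp add: cusp_domain_def)

lemma sets_cusp_domain[measurable]: "D \<in> sets borel"
proof -
  have "{u \<in> space (borel \<Otimes>\<^sub>M borel). 0 \<le> fst u \<and> fst u \<le> 1 \<and> 0 \<le> snd u \<and> snd u \<le> fst u powr k}
      \<in> sets (borel \<Otimes>\<^sub>M borel)"
    by measurable
  also have "{u \<in> space (borel \<Otimes>\<^sub>M borel). 0 \<le> fst u \<and> fst u \<le> 1 \<and> 0 \<le> snd u \<and> snd u \<le> fst u powr k} = D"
    by (auto simp: cusp_domain_def space_pair_measure)
  finally show ?thesis by (simp only: borel_prod)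
qed

lemma cusp_domain_subset_box: "D \<subseteq> cbox (0, 0) (1, 1)"
proof
  fix u assume "u \<in> D"
  from cusp_domain_memD[OF this] show "u \<in> cbox (0, 0) (1, 1)"
    by (cases u) (auto simp: cbox_Pair_eq)
qed

lemma emeasure_cusp_domain_le: "emeasure lborel D \<le> 1"
proof -
  have "emeasure lborel D \<le> emeasure lborel (cbox (0, 0) (1, 1) :: (real \<times> real) set)"
    by (intro emeasure_mono cusp_domain_subset_box) simp
  also have "\<dots> = 1" by (simp add: emeasure_lborel_cbox_eq Basis_prod_def)
  finally show ?thesis .
qed

lemma emeasure_cusp_domain: "emeasure lborel D = ennreal (measure lborel D)"
  using emeasure_cusp_domain_le by (intro emeasure_eq_ennreal_measure) (auto simp: top_unique)

lemma measure_cusp_domain_le: "measure lborel D \<le> 1"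
  using emeasure_cusp_domain_le by (simp add: emeasure_cusp_domain)

text \<open>Since \<open>k > 1\<close>, the first coordinate dominates on the cusp.\<close>

lemma infnorm_cusp_domain:
  assumes "u \<in> D"
  shows "infnorm u = fst u"
proof -
  have "infnorm (a, b) = max \<bar>a\<bar> \<bar>b\<bar>" for a b :: real
    by (simp add: infnorm_Max Basis_prod_def)
  from this[of "fst u" "snd u"] show ?thesis
    using cusp_domain_memD[OF assms] by simp
qed

lemma nbhd_cusp_domain: "nbhd D (0, 0) 1 = D"
proof -
  have "infnorm u \<le> 1" if "u \<in> D" for u
    using infnorm_cusp_domain[OF that] cusp_domain_memD[OF that] by simp
  then show ?thesis by (auto simp: nbhd_def zero_prod_def[symmetric])
qed

lemma dilation_simps[simp]: "fst (dilation h u) = h * fst u" "snd (dilation h u) = h powr k * snd u"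
  by (simp_all add: dilation_def)

lemma measurable_dilation[measurable]: "dilation h \<in> borel \<rightarrow>\<^sub>M borel"
proof -
  have "dilation h \<in> borel \<Otimes>\<^sub>M borel \<rightarrow>\<^sub>M borel \<Otimes>\<^sub>M borel" unfolding dilation_def[abs_def] by measurable
  then show ?thesis by (simp only: borel_prod)
qed

lemma lborel_dilation:
  assumes "0 < h"
  shows "lborel = density (distr lborel borel (dilation h)) (\<lambda>_. ennreal (h powr (k + 1)))"
proof -
  define c where "c j = (if j = (1, 0) then h else h powr k)" for j :: "real \<times> real"
  have "(\<lambda>x. (0, 0) + (\<Sum>j\<in>Basis. (c j * (x \<bullet> j)) *\<^sub>R j)) = dilation h"
    by (rule ext) (auto simp: Basis_prod_def c_def dilation_def sum.union_disjoint)
  moreover have "(\<Prod>j\<in>Basis. \<bar>c j\<bar>) = h powr (k + 1)"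
    using assms by (auto simp: Basis_prod_def c_def powr_add prod.union_disjoint)
  moreover have "c j \<noteq> 0" for j using assms by (simp add: c_def)
  ultimately show ?thesis using lborel_affine_euclidean[of c "(0, 0)"] by simp
qed

lemma nn_integral_dilation:
  assumes "0 < h" and [measurable]: "g \<in> borel_measurable borel"
  shows "(\<integral>\<^sup>+u. g u \<partial>lborel) = ennreal (h powr (k + 1)) * (\<integral>\<^sup>+v. g (dilation h v) \<partial>lborel)"
  by (subst lborel_dilation[OF assms(1)]) (simp add: nn_integral_density nn_integral_distr nn_integral_cmult)

lemma integral_dilation:
  fixes g :: "real \<times> real \<Rightarrow> real"
  assumes "0 < h" and [measurable]: "g \<in> borel_measurable borel"
  shows "(\<integral>u. g u \<partial>lborel) = h powr (k + 1) * (\<integral>v. g (dilation h v) \<partial>lborel)"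
  by (subst lborel_dilation[OF assms(1)]) (simp add: integral_density integral_distr)

lemma dilation_in_cusp_domain_iff:
  assumes "0 < h" "h \<le> 1"
  shows "v \<in> D \<longleftrightarrow> dilation h v \<in> D \<and> h * fst v \<le> h"
proof -
  have "h * fst v \<le> 1" if "fst v \<le> 1" "0 \<le> fst v" using that assms by (simp add: mult_le_one)
  then show ?thesis
    using assms
    by (cases v) (auto simp: cusp_domain_def dilation_def zero_le_mult_iff powr_mult mult_le_cancel_left_pos)
qed

lemma dilation_in_cusp_domain:
  assumes "0 < h" "h \<le> 1" "v \<in> D"
  shows "dilation h v \<in> D"
  using dilation_in_cusp_domain_iff assms by blast

text \<open>The dilation by \<open>h\<close> maps the cusp onto the support of the kernel weight of bandwidth \<open>h\<close>.\<close>

lemma kernel_weight_dilation: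
  assumes h: "0 < h" "h \<le> 1"
  shows "kernel_weight D (0, 0) h (dilation h v) = indicator D v / h\<^sup>2"
proof -
  have iff: "v \<in> D \<longleftrightarrow> dilation h v \<in> D \<and> inverse h *\<^sub>R dilation h v \<in> cbox (-1, -1) (1, 1)"
  proof (cases "dilation h v \<in> D")
    case True
    note mem = cusp_domain_memD[OF True]
    have "inverse h *\<^sub>R dilation h v \<in> cbox (-1, -1) (1, 1) \<longleftrightarrow> h * fst v \<le> h"
    proof -
      obtain X Y where XY: "dilation h v = (X, Y)" by fastforce
      have "inverse h * Y \<le> inverse h * X" "0 \<le> inverse h * Y" "0 \<le> inverse h * X"
        using mem h by (simp_all add: XY)
      moreover have "inverse h * X \<le> 1 \<longleftrightarrow> X \<le> h" using h by (simp add: field_simps)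
      moreover have "X = h * fst v" using XY by (simp add: dilation_def)
      ultimately show ?thesis unfolding XY by (auto simp: cbox_Pair_eq)
    qed
    then show ?thesis using True dilation_in_cusp_domain_iff[OF h] by blast
  next
    case False
    then show ?thesis using dilation_in_cusp_domain_iff[OF h] by blast
  qed
  have "(0, 0) + dilation h v = dilation h v" by (simp add: zero_prod_def[symmetric])
  then show ?thesis using iff by (auto simp: kernel_weight_def indicator_def)
qed

lemma monomial_dilation:
  assumes "0 < h"
  shows "monomial \<alpha> (dilation h v) = h powr (real (fst \<alpha>) + k * real (snd \<alpha>)) * monomial \<alpha> v"
  using assms by (simp add: monomial_def power_mult_distrib powr_add powr_realpow powr_power mult_ac)

text \<open>The features use the isotropic scaling \<open>u / h\<close>, so each power of the second coordinate leaves a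
  factor \<open>h powr (k - 1)\<close>.\<close>

lemma monomial_scaled_dilation:
  assumes "0 < h"
  shows "monomial \<alpha> (inverse h *\<^sub>R dilation h v) = h powr ((k - 1) * real (snd \<alpha>)) * monomial \<alpha> v"
proof -
  have "fst (inverse h *\<^sub>R dilation h v) = fst v" "snd (inverse h *\<^sub>R dilation h v) = h powr (k - 1) * snd v"
    using assms by (simp_all add: powr_diff field_simps)
  note coords = this
  show ?thesis
    unfolding monomial_def coords
    using assms by (simp add: power_mult_distrib powr_power mult_ac)
qed

lemma measurable_monomial[measurable]: "monomial \<alpha> \<in> borel_measurable borel"
proof -
  have "monomial \<alpha> \<in> borel_measurable (borel \<Otimes>\<^sub>M borel)"
    unfolding monomial_def[abs_def] by measurable
  then show ?thesis by (simp only: borel_prod)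
qed

lemma abs_monomial_le:
  assumes "u \<in> D"
  shows "\<bar>monomial \<alpha> u\<bar> \<le> fst u ^ (fst \<alpha> + snd \<alpha>)"
  using cusp_domain_memD[OF assms]
  by (auto simp: monomial_def abs_mult power_add power_abs intro!: mult_left_mono power_mono)

lemma abs_monomial_le_1:
  assumes "u \<in> D"
  shows "\<bar>monomial \<alpha> u\<bar> \<le> 1"
  using abs_monomial_le[OF assms, of \<alpha>] cusp_domain_memD[OF assms]
  by (meson order_trans power_le_one)

lemma integrable_cusp_domain:
  fixes g :: "real \<times> real \<Rightarrow> real"
  assumes [measurable]: "(\<lambda>u. g u * indicator D u) \<in> borel_measurable borel"
    and "\<And>u. u \<in> D \<Longrightarrow> \<bar>g u\<bar> \<le> c"
  shows "integrable lborel (\<lambda>u. g u * indicator D u)"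
proof (rule Bochner_Integration.integrable_bound)
  show "integrable lborel (\<lambda>u. c * indicator D u)"
    using emeasure_cusp_domain by (simp add: less_top)
  show "AE u in lborel. norm (g u * indicator D u) \<le> norm (c * indicator D u)"
    using assms(2) by (intro AE_I2) (fastforce simp: indicator_def)
qed simp

lemma abs_integral_cusp_domain_le:
  fixes g :: "real \<times> real \<Rightarrow> real"
  assumes "(\<lambda>u. g u * indicator D u) \<in> borel_measurable borel"
    and "\<And>u. u \<in> D \<Longrightarrow> \<bar>g u\<bar> \<le> c" and c: "0 \<le> c"
  shows "\<bar>\<integral>u. g u * indicator D u \<partial>lborel\<bar> \<le> c"
proof -
  have "\<bar>\<integral>u. g u * indicator D u \<partial>lborel\<bar> \<le> (\<integral>u. \<bar>g u * indicator D u\<bar> \<partial>lborel)"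
    by (rule integral_abs_bound)
  also have "\<dots> \<le> (\<integral>u. c * indicator D u \<partial>lborel)"
  proof (rule integral_mono)
    show "integrable lborel (\<lambda>u. \<bar>g u * indicator D u\<bar>)"
      using integrable_cusp_domain[of g c] assms by simp
    show "integrable lborel (\<lambda>u. c * indicator D u)"
      using emeasure_cusp_domain by (simp add: less_top)
    show "\<bar>g u * indicator D u\<bar> \<le> c * indicator D u" for u
      using assms(2) by (auto simp: indicator_def)
  qed
  also have "\<dots> = c * measure lborel D" by simp
  also have "\<dots> \<le> c" using c measure_cusp_domain_le by (simp add: mult_left_le)
  finally show ?thesis .
qed

end

section \<open>Moments of monomials on the cusp\<close>

lemma set_multi_indices: "set (multi_indices m) = {\<alpha>. fst \<alpha> + snd \<alpha> \<le> m}"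
proof (intro equalityI subsetI)
  fix \<alpha> assume "\<alpha> \<in> {\<alpha>. fst \<alpha> + snd \<alpha> \<le> m}"
  then show "\<alpha> \<in> set (multi_indices m)"
    by (cases \<alpha>) (auto simp: multi_indices_def image_iff intro!: bexI[of _ "fst \<alpha> + snd \<alpha>"])
qed (auto simp: multi_indices_def simp del: upt_Suc)

lemma distinct_multi_indices: "distinct (multi_indices m)"
proof (induction m)
  case 0
  then show ?case by (simp add: multi_indices_def)
next
  case (Suc m)
  have "multi_indices (Suc m) = multi_indices m @ map (\<lambda>i. (i, Suc m - i)) [0..<Suc (Suc m)]"
    by (simp add: multi_indices_def)
  moreover have "distinct (map (\<lambda>i. (i, Suc m - i)) [0..<Suc (Suc m)])"
    by (auto simp: distinct_map inj_on_def simp del: upt_Suc)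
  ultimately show ?case
    using Suc.IH by (auto simp: set_multi_indices simp del: upt_Suc)
qed

lemma finite_multi_indices[simp]: "finite {\<alpha>::nat \<times> nat. fst \<alpha> + snd \<alpha> \<le> m}"
  using finite_set[of "multi_indices m"] by (simp add: set_multi_indices)

lemma bij_betw_multi_indices:
  "bij_betw ((!) (multi_indices m)) {..<length (multi_indices m)} {\<alpha>. fst \<alpha> + snd \<alpha> \<le> m}"
  using bij_betw_nth[OF distinct_multi_indices refl refl, of m] by (simp add: set_multi_indices)

lemma sum_multi_indices:
  "(\<Sum>i<length (multi_indices m). g (multi_indices m ! i)) = (\<Sum>\<alpha>\<in>{\<alpha>. fst \<alpha> + snd \<alpha> \<le> m}. g \<alpha>)"
  by (rule sum.reindex_bij_betw[OF bij_betw_multi_indices])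

text \<open>A polynomial in two variables that vanishes on an open rectangle is zero.\<close>

lemma monomial_independent:
  assumes zero: "\<And>x y. a < x \<Longrightarrow> x < b \<Longrightarrow> a' < y \<Longrightarrow> y < b' \<Longrightarrow>
      (\<Sum>\<alpha>\<in>{\<alpha>. fst \<alpha> + snd \<alpha> \<le> m}. c \<alpha> * monomial \<alpha> (x, y)) = 0"
    and "a < b" "a' < b'" and \<alpha>: "fst \<alpha> + snd \<alpha> \<le> m"
  shows "c \<alpha> = 0"
proof -
  define e where "e i j = (if i + j \<le> m then c (i, j) else 0)" for i j
  have eq: "(\<Sum>\<alpha>\<in>{\<alpha>. fst \<alpha> + snd \<alpha> \<le> m}. c \<alpha> * monomial \<alpha> (x, y))
     = (\<Sum>i\<le>m. (\<Sum>j\<le>m. e i j * y ^ j) * x ^ i)" for x y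
  proof -
    have "(\<Sum>i\<le>m. (\<Sum>j\<le>m. e i j * y ^ j) * x ^ i) = (\<Sum>\<alpha>\<in>{..m} \<times> {..m}. e (fst \<alpha>) (snd \<alpha>) * monomial \<alpha> (x, y))"
      unfolding sum_distrib_right sum.cartesian_product
      by (intro sum.cong) (auto simp: monomial_def mult_ac)
    also have "\<dots> = (\<Sum>\<alpha>\<in>{\<alpha>. fst \<alpha> + snd \<alpha> \<le> m}. e (fst \<alpha>) (snd \<alpha>) * monomial \<alpha> (x, y))"
      by (rule sum.mono_neutral_right) (auto simp: e_def)
    also have "\<dots> = (\<Sum>\<alpha>\<in>{\<alpha>. fst \<alpha> + snd \<alpha> \<le> m}. c \<alpha> * monomial \<alpha> (x, y))"
      by (rule sum.cong) (auto simp: e_def)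
    finally show ?thesis by simp
  qed
  have vanish: "d i = 0" if "\<And>x. p < x \<Longrightarrow> x < q \<Longrightarrow> (\<Sum>i\<le>m. d i * x ^ i) = 0" "p < q" "i \<le> m"
    for d :: "nat \<Rightarrow> real" and p q i
  proof -
    have "{p<..<q} \<subseteq> {x. (\<Sum>i\<le>m. d i * x ^ i) = 0}" using that(1) by auto
    then have "infinite {x. (\<Sum>i\<le>m. d i * x ^ i) = 0}"
      using infinite_Ioo[OF that(2)] infinite_super by blast
    then show ?thesis using that(3) Transcendental.polyfun_finite_roots[where n = m and c = d] by blast
  qed
  have "(\<Sum>j\<le>m. e (fst \<alpha>) j * y ^ j) = 0" if "a' < y" "y < b'" for y
    by (rule vanish[of a b "\<lambda>i. \<Sum>j\<le>m. e i j * y ^ j" "fst \<alpha>"])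
      (use zero that eq \<alpha> \<open>a < b\<close> in auto)
  then have "e (fst \<alpha>) (snd \<alpha>) = 0"
    using vanish[of a' b' "e (fst \<alpha>)" "snd \<alpha>"] \<alpha> \<open>a' < b'\<close> by auto
  then show ?thesis using \<alpha> by (simp add: e_def)
qed

context cusp
begin

text \<open>The Gram matrix of the monomials in \<open>L\<^sup>2\<close> of the cusp.\<close>

definition moment :: "nat \<times> nat \<Rightarrow> nat \<times> nat \<Rightarrow> real" where
  "moment \<alpha> \<beta> = (\<integral>u. monomial \<alpha> u * monomial \<beta> u * indicator D u \<partial>lborel)"

lemma integrable_moment: "integrable lborel (\<lambda>u. monomial \<alpha> u * monomial \<beta> u * indicator D u)"
proof (rule integrable_cusp_domain)
  show "\<bar>monomial \<alpha> u * monomial \<beta> u\<bar> \<le> 1" if "u \<in> D" for u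
    using abs_monomial_le_1[OF that, of \<alpha>] abs_monomial_le_1[OF that, of \<beta>]
    by (simp add: abs_mult mult_le_one)
qed measurable

lemma moment_commute: "moment \<alpha> \<beta> = moment \<beta> \<alpha>"
  by (simp add: moment_def mult_ac)

lemma integral_sum_moment:
  assumes "finite A" "finite B"
  shows "(\<integral>u. (\<Sum>i\<in>A. a i * monomial (p i) u) * (\<Sum>j\<in>B. b j * monomial (q j) u) * indicator D u \<partial>lborel)
    = (\<Sum>i\<in>A. \<Sum>j\<in>B. a i * moment (p i) (q j) * b j)"
proof -
  have "(\<Sum>i\<in>A. a i * monomial (p i) u) * (\<Sum>j\<in>B. b j * monomial (q j) u) * indicator D u
      = (\<Sum>i\<in>A. \<Sum>j\<in>B. (a i * b j) * (monomial (p i) u * monomial (q j) u * indicator D u))" for u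
    unfolding sum_product unfolding sum_distrib_right by (simp only: mult_ac)
  then have "(\<integral>u. (\<Sum>i\<in>A. a i * monomial (p i) u) * (\<Sum>j\<in>B. b j * monomial (q j) u) * indicator D u \<partial>lborel)
      = (\<Sum>i\<in>A. \<integral>u. (\<Sum>j\<in>B. (a i * b j) * (monomial (p i) u * monomial (q j) u * indicator D u)) \<partial>lborel)"
    by (simp only:) (intro Bochner_Integration.integral_sum Bochner_Integration.integrable_sum
        integrable_mult_right integrable_moment)
  also have "\<dots> = (\<Sum>i\<in>A. \<Sum>j\<in>B. \<integral>u. (a i * b j) * (monomial (p i) u * monomial (q j) u * indicator D u) \<partial>lborel)"
    by (intro sum.cong refl Bochner_Integration.integral_sum integrable_mult_right integrable_moment)
  also have "\<dots> = (\<Sum>i\<in>A. \<Sum>j\<in>B. a i * moment (p i) (q j) * b j)"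
    by (simp add: moment_def mult_ac)
  finally show ?thesis .
qed

text \<open>The quadratic form is the squared \<open>L\<^sup>2\<close> norm of a polynomial on the cusp. If it is zero, the
  polynomial vanishes almost everywhere on the cusp, hence on an open rectangle inside it.\<close>

lemma moment_positive_definite:
  assumes "\<exists>i<length (multi_indices m). y i \<noteq> 0"
  shows "0 < (\<Sum>i<length (multi_indices m). \<Sum>j<length (multi_indices m).
      y i * moment (multi_indices m ! i) (multi_indices m ! j) * y j)"
proof -
  let ?N = "length (multi_indices m)"
  define p where "p u = (\<Sum>i<?N. y i * monomial (multi_indices m ! i) u)" for u
  have [measurable]: "p \<in> borel_measurable borel" unfolding p_def[abs_def] by measurable
  have eq: "(\<Sum>i<?N. \<Sum>j<?N. y i * moment (multi_indices m ! i) (multi_indices m ! j) * y j)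
      = (\<integral>u. p u * p u * indicator D u \<partial>lborel)"
    unfolding p_def by (rule integral_sum_moment[symmetric]) auto
  have int: "integrable lborel (\<lambda>u. p u * p u * indicator D u)"
  proof (rule integrable_cusp_domain)
    fix u assume u: "u \<in> D"
    have "\<bar>p u\<bar> \<le> (\<Sum>i<?N. \<bar>y i * monomial (multi_indices m ! i) u\<bar>)" unfolding p_def by (rule sum_abs)
    also have "\<dots> \<le> (\<Sum>i<?N. \<bar>y i\<bar>)"
      using abs_monomial_le_1[OF u] by (intro sum_mono) (simp add: abs_mult mult_left_le)
    finally show "\<bar>p u * p u\<bar> \<le> (\<Sum>i<?N. \<bar>y i\<bar>) * (\<Sum>i<?N. \<bar>y i\<bar>)"
      unfolding abs_mult by (intro mult_mono) auto
  qed measurable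
  have "(\<integral>u. p u * p u * indicator D u \<partial>lborel) \<noteq> 0"
  proof
    assume 0: "(\<integral>u. p u * p u * indicator D u \<partial>lborel) = 0"
    have "AE u in lborel. p u * p u * indicator D u = 0"
      using integral_nonneg_eq_0_iff_AE[OF int] 0 by (auto simp: indicator_def)
    then have AE: "AE u in lborel. u \<in> D \<longrightarrow> p u = 0" by eventually_elim (auto simp: indicator_def)
    \<comment> \<open>an open rectangle in the cusp\<close>
    define U where "U = {1/2<..<1::real} \<times> {0<..<(1/2) powr k}"
    have "open U" unfolding U_def by (intro open_Times) auto
    moreover have "continuous_on UNIV p"
      unfolding p_def monomial_def by (intro continuous_intros)
    ultimately have "open (U \<inter> {u. p u \<noteq> 0})"
      by (intro open_Int open_Collect_neq continuous_on_const) auto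
    moreover have UD: "U \<subseteq> D"
    proof
      fix u assume "u \<in> U"
      then have "1/2 < fst u" "fst u < 1" "0 < snd u" "snd u < (1/2) powr k" by (auto simp: U_def)
      moreover from this have "(1/2) powr k \<le> fst u powr k" using k_gt_1 by (intro powr_mono2) auto
      ultimately show "u \<in> D" by (auto simp: cusp_domain_def case_prod_unfold)
    qed
    have "negligible (U \<inter> {u. p u \<noteq> 0})"
    proof -
      have "AE u in lborel. u \<notin> U \<inter> {u. p u \<noteq> 0}" using AE by eventually_elim (use UD in auto)
      moreover have "U \<inter> {u. p u \<noteq> 0} \<in> sets lborel"
        using \<open>open (U \<inter> {u. p u \<noteq> 0})\<close> by simp
      ultimately have "U \<inter> {u. p u \<noteq> 0} \<in> null_sets lborel" by (simp add: AE_iff_null_sets)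
      then show ?thesis by (simp add: negligible_iff_null_sets null_sets_completionI)
    qed
    ultimately have empty: "U \<inter> {u. p u \<noteq> 0} = {}" using open_not_negligible by blast
    define c where "c = y \<circ> inv_into {..<?N} ((!) (multi_indices m))"
    have c: "c (multi_indices m ! i) = y i" if "i < ?N" for i
      using bij_betw_inv_into_left[OF bij_betw_multi_indices, of i m] that by (simp add: c_def)
    have pc: "p u = (\<Sum>\<alpha>\<in>{\<alpha>. fst \<alpha> + snd \<alpha> \<le> m}. c \<alpha> * monomial \<alpha> u)" for u
      unfolding sum_multi_indices[symmetric] p_def using c by (intro sum.cong) auto
    have "c \<alpha> = 0" if "fst \<alpha> + snd \<alpha> \<le> m" for \<alpha>
    proof (rule monomial_independent[OF _ _ _ that])
      show "(\<Sum>\<alpha>\<in>{\<alpha>. fst \<alpha> + snd \<alpha> \<le> m}. c \<alpha> * monomial \<alpha> (x, y)) = 0"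
        if "1/2 < x" "x < 1" "0 < y" "y < (1/2) powr k" for x y
      proof -
        have "(x, y) \<in> U" using that by (simp add: U_def)
        then show ?thesis using empty pc by auto
      qed
    qed auto
    moreover have "multi_indices m ! i \<in> {\<alpha>. fst \<alpha> + snd \<alpha> \<le> m}" if "i < ?N" for i
      using that unfolding set_multi_indices[symmetric] by simp
    ultimately show False using assms c by fastforce
  qed
  moreover have "0 \<le> (\<integral>u. p u * p u * indicator D u \<partial>lborel)"
    by (intro Bochner_Integration.integral_nonneg) (simp add: indicator_def)
  ultimately show ?thesis unfolding eq by linarith
qed

text \<open>The Gram matrix at bandwidth \<open>h\<close> is that of the cusp, conjugated by a diagonal matrix and
  multiplied by a power of \<open>h\<close>. In particular it is positive definite.\<close>

lemma gram_matrix_dilation: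
  assumes h: "0 < h" "h \<le> 1" and ij: "i < length (multi_indices m)" "j < length (multi_indices m)"
  shows "gram_matrix D (0, 0) m h $$ (i, j) =
    h powr (k - 1) * (h powr ((k - 1) * real (snd (multi_indices m ! i)))
      * moment (multi_indices m ! i) (multi_indices m ! j)
      * h powr ((k - 1) * real (snd (multi_indices m ! j))))"
proof -
  let ?\<alpha> = "multi_indices m ! i" and ?\<beta> = "multi_indices m ! j"
  have [measurable]: "kernel_weight D (0, 0) h \<in> borel_measurable borel"
  proof -
    have [measurable]: "(\<lambda>u. inverse h *\<^sub>R u :: real \<times> real) \<in> borel \<rightarrow>\<^sub>M borel"
      "(\<lambda>u. (0, 0) + u :: real \<times> real) \<in> borel \<rightarrow>\<^sub>M borel"
      by (intro borel_measurable_continuous_onI continuous_intros)+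
    show ?thesis unfolding kernel_weight_def[abs_def] by measurable
  qed
  have [measurable]: "(\<lambda>u. monomial \<alpha> (inverse h *\<^sub>R u)) \<in> borel_measurable borel" for \<alpha>
    by (rule measurable_compose[OF _ measurable_monomial])
      (intro borel_measurable_continuous_onI continuous_intros)
  have "gram_matrix D (0, 0) m h $$ (i, j)
     = (\<integral>u. monomial ?\<alpha> (inverse h *\<^sub>R u) * monomial ?\<beta> (inverse h *\<^sub>R u) * kernel_weight D (0, 0) h u \<partial>lborel)"
    using ij by (simp add: gram_matrix_def feature_vec_def vec_of_list_index)
  also have "\<dots> = h powr (k + 1) * (\<integral>v. monomial ?\<alpha> (inverse h *\<^sub>R dilation h v)
      * monomial ?\<beta> (inverse h *\<^sub>R dilation h v) * kernel_weight D (0, 0) h (dilation h v) \<partial>lborel)"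
    by (rule integral_dilation) (use h in auto)
  also have "\<dots> = h powr (k + 1) * (\<integral>v. h powr ((k - 1) * real (snd ?\<alpha>)) * h powr ((k - 1) * real (snd ?\<beta>)) / h\<^sup>2
      * (monomial ?\<alpha> v * monomial ?\<beta> v * indicator D v) \<partial>lborel)"
    using h by (simp add: monomial_scaled_dilation kernel_weight_dilation mult_ac)
  also have "\<dots> = h powr (k + 1) / h\<^sup>2 * (h powr ((k - 1) * real (snd ?\<alpha>)) * moment ?\<alpha> ?\<beta> * h powr ((k - 1) * real (snd ?\<beta>)))"
    by (simp add: moment_def)
  also have "h powr (k + 1) / h\<^sup>2 = h powr (k - 1)"
  proof -
    have "h powr (k + 1) = h powr (k - 1) * h powr 2" by (simp add: powr_add[symmetric] add.commute)
    then show ?thesis using h by (simp add: powr_numeral)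
  qed
  finally show ?thesis .
qed

lemma gram_matrix_carrier:
  "gram_matrix D (0, 0) m h \<in> carrier_mat (length (multi_indices m)) (length (multi_indices m))"
  by (simp add: gram_matrix_def)

lemma gram_matrix_inverse:
  assumes h: "0 < h" "h \<le> 1"
  obtains M where "mat_inverse (cholesky (gram_matrix D (0, 0) m h)) = Some M"
    "M \<in> carrier_mat (length (multi_indices m)) (length (multi_indices m))"
    "gram_matrix D (0, 0) m h * (transpose_mat M * M) = 1\<^sub>m (length (multi_indices m))"
proof (rule cholesky_inverse[OF gram_matrix_carrier])
  let ?N = "length (multi_indices m)"
  let ?s = "\<lambda>i. h powr ((k - 1) * real (snd (multi_indices m ! i)))"
  show "gram_matrix D (0, 0) m h $$ (i, j) = gram_matrix D (0, 0) m h $$ (j, i)" if "i < ?N" "j < ?N" for i j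
    using that h by (simp add: gram_matrix_dilation moment_commute[of "multi_indices m ! i"] mult_ac)
  show "0 < (\<Sum>i<?N. \<Sum>j<?N. x i * gram_matrix D (0, 0) m h $$ (i, j) * x j)" if x: "\<exists>i<?N. x i \<noteq> 0" for x
  proof -
    have "(\<Sum>i<?N. \<Sum>j<?N. x i * gram_matrix D (0, 0) m h $$ (i, j) * x j)
       = (\<Sum>i<?N. \<Sum>j<?N. h powr (k - 1) * ((x i * ?s i) * moment (multi_indices m ! i) (multi_indices m ! j) * (x j * ?s j)))"
      using h by (intro sum.cong refl) (simp add: gram_matrix_dilation mult_ac)
    also have "\<dots> = h powr (k - 1) * (\<Sum>i<?N. \<Sum>j<?N. (x i * ?s i) * moment (multi_indices m ! i) (multi_indices m ! j) * (x j * ?s j))"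
      by (simp add: sum_distrib_left)
    also have "\<dots> > 0"
      using x h by (intro mult_pos_pos moment_positive_definite) auto
    finally show ?thesis .
  qed
qed (use that in blast)

end

section \<open>The equivalent kernel of the estimator\<close>

context cusp
begin

lemma moment_solution_unique:
  assumes "\<And>i. i < length (multi_indices m) \<Longrightarrow>
      (\<Sum>j<length (multi_indices m). moment (multi_indices m ! i) (multi_indices m ! j) * b j)
      = (\<Sum>j<length (multi_indices m). moment (multi_indices m ! i) (multi_indices m ! j) * b' j)"
    and "j < length (multi_indices m)"
  shows "b j = b' j"
proof (rule ccontr)
  let ?N = "length (multi_indices m)"
  assume "b j \<noteq> b' j"
  then have "0 < (\<Sum>i<?N. \<Sum>j<?N. (b i - b' i) * moment (multi_indices m ! i) (multi_indices m ! j) * (b j - b' j))"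
    using assms(2) by (intro moment_positive_definite) auto
  also have "\<dots> = (\<Sum>i<?N. (b i - b' i) * ((\<Sum>j<?N. moment (multi_indices m ! i) (multi_indices m ! j) * b j)
      - (\<Sum>j<?N. moment (multi_indices m ! i) (multi_indices m ! j) * b' j)))"
    unfolding sum_subtractf[symmetric] sum_distrib_left by (simp add: algebra_simps)
  also have "\<dots> = 0" using assms(1) by (intro sum.neutral) auto
  finally show False by simp
qed

text \<open>The weight of an observation depends on the Cholesky factor only through the inverse of the Gram
  matrix \<open>B\<close>: it is the scalar product of the feature vector with the solution \<open>a\<close> of \<open>B a = \<Phi>(0)\<close>,
  and \<open>\<Phi>(0)\<close> is the unit vector of the constant monomial.\<close>

lemma estimator_weight_vector:
  assumes h: "0 < h" "h \<le> 1"
  obtains a where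
    "\<And>i. i < length (multi_indices m) \<Longrightarrow>
      (\<Sum>j<length (multi_indices m). gram_matrix D (0, 0) m h $$ (i, j) * a j)
      = (if multi_indices m ! i = (0, 0) then 1 else 0)"
    "\<And>u. scalar_prod (basis_vec D (0, 0) m h 0) (basis_vec D (0, 0) m h u)
      = (\<Sum>j<length (multi_indices m). a j * monomial (multi_indices m ! j) (inverse h *\<^sub>R u))"
proof -
  let ?N = "length (multi_indices m)" and ?B = "gram_matrix D (0, 0) m h"
  from gram_matrix_inverse[OF h, of m] obtain M where
    M: "mat_inverse (cholesky ?B) = Some M" "M \<in> carrier_mat ?N ?N" "?B * (transpose_mat M * M) = 1\<^sub>m ?N"
    by blast
  define \<phi> where "\<phi> u = feature_vec m h u" for u
  have \<phi>_carrier: "\<phi> u \<in> carrier_vec ?N" for u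
    by (rule carrier_vecI) (simp add: \<phi>_def feature_vec_def)
  have \<phi>_index: "vec_index (\<phi> u) i = monomial (multi_indices m ! i) (inverse h *\<^sub>R u)" if "i < ?N" for u i
    using that by (simp add: \<phi>_def feature_vec_def vec_of_list_index)
  have K: "transpose_mat M * M \<in> carrier_mat ?N ?N" using M(2) by simp
  define a where "a = (transpose_mat M * M) *\<^sub>v \<phi> 0"
  have a: "a \<in> carrier_vec ?N" 
    unfolding a_def by (rule mult_mat_vec_carrier[OF K \<phi>_carrier])
  have "?B *\<^sub>v a = (?B * (transpose_mat M * M)) *\<^sub>v \<phi> 0"
    unfolding a_def by (rule assoc_mult_mat_vec[OF gram_matrix_carrier K \<phi>_carrier, symmetric])
  also have "\<dots> = \<phi> 0" unfolding M(3) by (rule one_mult_mat_vec[OF \<phi>_carrier])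
  finally have Ba: "?B *\<^sub>v a = \<phi> 0" .
  have 1: "(\<Sum>j<?N. ?B $$ (i, j) * vec_index a j) = (if multi_indices m ! i = (0, 0) then 1 else 0)" if i: "i < ?N" for i
  proof -
    have "(\<Sum>j<?N. ?B $$ (i, j) * vec_index a j) = vec_index (?B *\<^sub>v a) i"
      using i a gram_matrix_carrier[of m h] by (auto simp: scalar_prod_def lessThan_atLeast0)
    also have "\<dots> = monomial (multi_indices m ! i) 0" unfolding Ba using \<phi>_index[OF i, of 0] by simp
    also have "\<dots> = (if multi_indices m ! i = (0, 0) then 1 else 0)"
      by (cases "multi_indices m ! i") (auto simp: monomial_def power_0_left)
    finally show ?thesis .
  qed
  have 2: "scalar_prod (basis_vec D (0, 0) m h 0) (basis_vec D (0, 0) m h u)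
      = (\<Sum>j<?N. vec_index a j * monomial (multi_indices m ! j) (inverse h *\<^sub>R u))" for u
  proof -
    have "scalar_prod (basis_vec D (0, 0) m h 0) (basis_vec D (0, 0) m h u)
        = scalar_prod (M *\<^sub>v \<phi> 0) (M *\<^sub>v \<phi> u)"
      using M(1) by (simp add: basis_vec_def \<phi>_def)
    also have "\<dots> = scalar_prod (transpose_mat M *\<^sub>v (M *\<^sub>v \<phi> 0)) (\<phi> u)"
      by (rule transpose_vec_mult_scalar[symmetric, OF M(2) \<phi>_carrier mult_mat_vec_carrier[OF M(2) \<phi>_carrier]])
    also have "transpose_mat M *\<^sub>v (M *\<^sub>v \<phi> 0) = a"
      unfolding a_def by (rule assoc_mult_mat_vec[OF _ M(2) \<phi>_carrier, symmetric]) (use M(2) in simp)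
    also have "scalar_prod a (\<phi> u) = (\<Sum>j<?N. vec_index a j * monomial (multi_indices m ! j) (inverse h *\<^sub>R u))"
      
      using \<phi>_index[of _ u] carrier_vecD[OF \<phi>_carrier, of u]
      by (simp add: scalar_prod_def lessThan_atLeast0)
    finally show ?thesis .
  qed
  show ?thesis by (rule that[of "vec_index a"]) (use 1 2 in auto)
qed

text \<open>After rescaling, the solution at bandwidth \<open>h\<close> solves a linear system that does not involve \<open>h\<close>.
  The right-hand side is unaffected because the diagonal factor of the constant monomial is \<open>1\<close>.\<close>

lemma estimator_weight_scaling:
  assumes h: "0 < h" "h \<le> 1"
    and a: "\<And>i. i < length (multi_indices m) \<Longrightarrow>
      (\<Sum>j<length (multi_indices m). gram_matrix D (0, 0) m h $$ (i, j) * a j)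
      = (if multi_indices m ! i = (0, 0) then 1 else 0)"
    and i: "i < length (multi_indices m)"
  shows "(\<Sum>j<length (multi_indices m). moment (multi_indices m ! i) (multi_indices m ! j)
      * (h powr (k - 1) * h powr ((k - 1) * real (snd (multi_indices m ! j))) * a j))
    = (if multi_indices m ! i = (0, 0) then 1 else 0)"
proof -
  let ?N = "length (multi_indices m)"
  let ?s = "\<lambda>i. h powr ((k - 1) * real (snd (multi_indices m ! i)))"
  have "?s i * (\<Sum>j<?N. moment (multi_indices m ! i) (multi_indices m ! j) * (h powr (k - 1) * ?s j * a j))
      = (\<Sum>j<?N. gram_matrix D (0, 0) m h $$ (i, j) * a j)"
    unfolding sum_distrib_left using h i by (intro sum.cong refl) (simp add: gram_matrix_dilation mult_ac)
  also have "\<dots> = (if multi_indices m ! i = (0, 0) then 1 else 0)" by (rule a[OF i])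
  finally have "?s i * (\<Sum>j<?N. moment (multi_indices m ! i) (multi_indices m ! j) * (h powr (k - 1) * ?s j * a j))
      = (if multi_indices m ! i = (0, 0) then 1 else 0)" .
  moreover have "?s i > 0" using h by simp
  moreover have "?s i = 1" if "multi_indices m ! i = (0, 0)" using that h by simp
  ultimately show ?thesis by (auto split: if_splits)
qed

lemma poly_space_dilation:
  assumes "p \<in> poly_space m" "0 < h"
  shows "(\<lambda>v. p (dilation h v)) \<in> poly_space m"
proof -
  from assms(1) obtain c where p: "p = (\<lambda>u. \<Sum>\<alpha>\<in>{\<alpha>. fst \<alpha> + snd \<alpha> \<le> m}. c \<alpha> * monomial \<alpha> u)"
    by (auto simp: poly_space_def)
  have "(\<lambda>v. p (dilation h v)) = (\<lambda>u. \<Sum>\<alpha>\<in>{\<alpha>. fst \<alpha> + snd \<alpha> \<le> m}.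
      (c \<alpha> * h powr (real (fst \<alpha>) + k * real (snd \<alpha>))) * monomial \<alpha> u)"
    using assms(2) by (simp add: p monomial_dilation mult_ac)
  then show ?thesis unfolding poly_space_def mem_Collect_eq 
    by (rule exI[where x = "\<lambda>\<alpha>. c \<alpha> * h powr (real (fst \<alpha>) + k * real (snd \<alpha>))"])
qed

lemma measurable_poly_space:
  assumes "p \<in> poly_space m"
  shows "p \<in> borel_measurable borel"
proof -
  from assms obtain c where p: "p = (\<lambda>u. \<Sum>\<alpha>\<in>{\<alpha>. fst \<alpha> + snd \<alpha> \<le> m}. c \<alpha> * monomial \<alpha> u)"
    by (auto simp: poly_space_def)
  show ?thesis unfolding p by measurable
qed

text \<open>The weights of the estimator at all bandwidths are dilations of one bounded kernel \<open>G\<close> on the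
  cusp, which integrates every polynomial of degree at most \<open>m\<close> to its value at the origin.\<close>

lemma equivalent_kernel:
  obtains G A where "G \<in> borel_measurable borel" "0 \<le> A" "\<And>v. v \<in> D \<Longrightarrow> \<bar>G v\<bar> \<le> A"
    "\<And>p. p \<in> poly_space m \<Longrightarrow> (\<integral>v. G v * p v * indicator D v \<partial>lborel) = p (0, 0)"
    "\<And>h v. 0 < h \<Longrightarrow> h \<le> 1 \<Longrightarrow>
      scalar_prod (basis_vec D (0, 0) m h 0) (basis_vec D (0, 0) m h (dilation h v))
        * kernel_weight D (0, 0) h (dilation h v)
      = h powr (- (k + 1)) * (G v * indicator D v)"
proof -
  let ?N = "length (multi_indices m)"
  let ?s = "\<lambda>h i. h powr ((k - 1) * real (snd (multi_indices m ! i)))"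
  have unit_scale: "(0::real) < 1" "(1::real) \<le> 1" by simp_all
  obtain g where g0: "\<And>i. i < ?N \<Longrightarrow> (\<Sum>j<?N. gram_matrix D (0, 0) m 1 $$ (i, j) * g j)
      = (if multi_indices m ! i = (0, 0) then 1 else 0)"
    using estimator_weight_vector[of 1 m, OF unit_scale] by blast
  have g: "(\<Sum>j<?N. moment (multi_indices m ! i) (multi_indices m ! j) * g j)
      = (if multi_indices m ! i = (0, 0) then 1 else 0)" if "i < ?N" for i
    using estimator_weight_scaling[of 1 m g i] g0 that by simp
  define G where "G v = (\<Sum>j<?N. g j * monomial (multi_indices m ! j) v)" for v
  have meas: "G \<in> borel_measurable borel" unfolding G_def[abs_def] by measurable
  have bound: "\<bar>G v\<bar> \<le> (\<Sum>j<?N. \<bar>g j\<bar>)" if "v \<in> D" for v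
    unfolding G_def using abs_monomial_le_1[OF that]
    by (intro order_trans[OF sum_abs] sum_mono) (simp add: abs_mult mult_left_le)
  have repro: "(\<integral>v. G v * p v * indicator D v \<partial>lborel) = p (0, 0)" if "p \<in> poly_space m" for p
  proof -
    from that obtain c where p: "p = (\<lambda>u. \<Sum>\<alpha>\<in>{\<alpha>. fst \<alpha> + snd \<alpha> \<le> m}. c \<alpha> * monomial \<alpha> u)"
      by (auto simp: poly_space_def)
    have p': "p u = (\<Sum>i<?N. c (multi_indices m ! i) * monomial (multi_indices m ! i) u)" for u
      unfolding p by (rule sum_multi_indices[where g = "\<lambda>\<alpha>. c \<alpha> * monomial \<alpha> u", symmetric])
    have "(\<integral>v. G v * p v * indicator D v \<partial>lborel)
        = (\<Sum>j<?N. \<Sum>i<?N. g j * moment (multi_indices m ! j) (multi_indices m ! i) * c (multi_indices m ! i))"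
      unfolding G_def p' by (rule integral_sum_moment) auto
    also have "\<dots> = (\<Sum>i<?N. c (multi_indices m ! i) * (\<Sum>j<?N. moment (multi_indices m ! i) (multi_indices m ! j) * g j))"
      unfolding sum_distrib_left by (subst sum.swap) (simp add: moment_commute mult_ac)
    also have "\<dots> = (\<Sum>i<?N. c (multi_indices m ! i) * monomial (multi_indices m ! i) (0, 0))"
    proof (intro sum.cong refl)
      fix i assume "i \<in> {..<?N}"
      then show "c (multi_indices m ! i) * (\<Sum>j<?N. moment (multi_indices m ! i) (multi_indices m ! j) * g j)
          = c (multi_indices m ! i) * monomial (multi_indices m ! i) (0, 0)"
        using g[of i] by (cases "multi_indices m ! i") (auto simp: monomial_def power_0_left)
    qed
    finally show ?thesis unfolding p' .
  qed
  have weight: "scalar_prod (basis_vec D (0, 0) m h 0) (basis_vec D (0, 0) m h (dilation h v))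
        * kernel_weight D (0, 0) h (dilation h v) = h powr (- (k + 1)) * (G v * indicator D v)"
    if h: "0 < h" "h \<le> 1" for h v
  proof -
    obtain a where a: "\<And>i. i < ?N \<Longrightarrow> (\<Sum>j<?N. gram_matrix D (0, 0) m h $$ (i, j) * a j)
        = (if multi_indices m ! i = (0, 0) then 1 else 0)"
      "\<And>u. scalar_prod (basis_vec D (0, 0) m h 0) (basis_vec D (0, 0) m h u)
        = (\<Sum>j<?N. a j * monomial (multi_indices m ! j) (inverse h *\<^sub>R u))"
      using estimator_weight_vector[OF h, of m] by blast
    have eq: "h powr (k - 1) * ?s h j * a j = g j" if "j < ?N" for j
      by (rule moment_solution_unique[OF _ that]) (use estimator_weight_scaling[OF h a(1)] g in simp)
    have "a j * monomial (multi_indices m ! j) (inverse h *\<^sub>R dilation h v)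
        = h powr (- (k - 1)) * (g j * monomial (multi_indices m ! j) v)" if "j < ?N" for j
    proof -
      have one: "h powr (- (k - 1)) * h powr (k - 1) = 1" using h by (simp add: powr_add[symmetric])
      have "h powr (- (k - 1)) * (h powr (k - 1) * ?s h j * a j * monomial (multi_indices m ! j) v)
          = h powr (- (k - 1)) * h powr (k - 1) * (a j * (?s h j * monomial (multi_indices m ! j) v))"
        by (simp only: mult_ac)
      then show ?thesis
        unfolding one monomial_scaled_dilation[OF h(1)] eq[OF that, symmetric] by (simp only: mult_1_left)
    qed
    then have weights: "(\<Sum>j<?N. a j * monomial (multi_indices m ! j) (inverse h *\<^sub>R dilation h v)) = h powr (- (k - 1)) * G v"
      unfolding G_def sum_distrib_left by (intro sum.cong) auto
    have exponent: "h powr (- (k - 1)) / h\<^sup>2 = h powr (- (k + 1))"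
    proof -
      have "h powr (- (k - 1)) = h powr (- (k + 1)) * h powr 2"
        unfolding powr_add[symmetric] by simp
      then show ?thesis using h by (simp add: powr_numeral)
    qed
    show ?thesis
      unfolding a(2) kernel_weight_dilation[OF h] weights exponent[symmetric] by simp
  qed
  show ?thesis
    by (rule that[of G "\<Sum>j<?N. \<bar>g j\<bar>"]) (use meas bound repro weight in \<open>auto intro: sum_nonneg\<close>)
qed

text \<open>Each coefficient of a polynomial is its integral against a polynomial of the dual basis, which is
  bounded on the cusp.\<close>

lemma coefficients_bounded_by_L1:
  obtains C where "0 \<le> C"
    "\<And>c \<alpha>. fst \<alpha> + snd \<alpha> \<le> m \<Longrightarrow> \<bar>c \<alpha>\<bar> \<le>
      C * (\<integral>u. \<bar>\<Sum>\<beta>\<in>{\<beta>. fst \<beta> + snd \<beta> \<le> m}. c \<beta> * monomial \<beta> u\<bar> * indicator D u \<partial>lborel)"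
proof -
  let ?N = "length (multi_indices m)" and ?B = "gram_matrix D (0, 0) m 1"
  have unit_scale: "(0::real) < 1" "(1::real) \<le> 1" by simp_all
  obtain M where M: "M \<in> carrier_mat ?N ?N" "?B * (transpose_mat M * M) = 1\<^sub>m ?N"
    using gram_matrix_inverse[of 1 m, OF unit_scale] by blast
  define K where "K = transpose_mat M * M"
  have K: "K \<in> carrier_mat ?N ?N" "?B * K = 1\<^sub>m ?N" using M by (auto simp: K_def)
  have dual: "(\<Sum>j<?N. moment (multi_indices m ! i) (multi_indices m ! j) * K $$ (j, l)) = (if i = l then 1 else 0)"
    if il: "i < ?N" "l < ?N" for i l
  proof -
    have "(?B * K) $$ (i, l) = (\<Sum>j<?N. ?B $$ (i, j) * K $$ (j, l))"
      using il K(1) gram_matrix_carrier[of m 1] by (auto simp: scalar_prod_def lessThan_atLeast0)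
    also have "\<dots> = (\<Sum>j<?N. moment (multi_indices m ! i) (multi_indices m ! j) * K $$ (j, l))"
      using il by (intro sum.cong refl) (simp add: gram_matrix_dilation)
    finally show ?thesis using K(2) il by simp
  qed
  define C where "C = (\<Sum>l<?N. \<Sum>j<?N. \<bar>K $$ (j, l)\<bar>)"
  have "0 \<le> C" by (auto simp: C_def intro!: sum_nonneg)
  moreover have "\<bar>c \<alpha>\<bar> \<le> C * (\<integral>u. \<bar>\<Sum>\<beta>\<in>{\<beta>. fst \<beta> + snd \<beta> \<le> m}. c \<beta> * monomial \<beta> u\<bar> * indicator D u \<partial>lborel)"
    if \<alpha>: "fst \<alpha> + snd \<alpha> \<le> m" for c \<alpha>
  proof -
    from \<alpha> have "\<alpha> \<in> set (multi_indices m)" by (simp add: set_multi_indices)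
    then obtain l where l: "l < ?N" "multi_indices m ! l = \<alpha>" by (auto simp: in_set_conv_nth)
    define q where "q u = (\<Sum>\<beta>\<in>{\<beta>. fst \<beta> + snd \<beta> \<le> m}. c \<beta> * monomial \<beta> u)" for u
    have q: "q u = (\<Sum>i<?N. c (multi_indices m ! i) * monomial (multi_indices m ! i) u)" for u
      unfolding q_def by (rule sum_multi_indices[where g = "\<lambda>\<alpha>. c \<alpha> * monomial \<alpha> u", symmetric])
    \<comment> \<open>the dual basis polynomial that belongs to \<open>\<alpha>\<close>\<close>
    define P where "P u = (\<Sum>j<?N. K $$ (j, l) * monomial (multi_indices m ! j) u)" for u
    have [measurable]: "P \<in> borel_measurable borel" "q \<in> borel_measurable borel"
      unfolding P_def[abs_def] q_def[abs_def] by measurable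
    have P: "\<bar>P u\<bar> \<le> C" if "u \<in> D" for u
    proof -
      have "\<bar>P u\<bar> \<le> (\<Sum>j<?N. \<bar>K $$ (j, l)\<bar>)"
        unfolding P_def using abs_monomial_le_1[OF that]
        by (intro order_trans[OF sum_abs] sum_mono) (simp add: abs_mult mult_left_le)
      also have "\<dots> \<le> C"
        unfolding C_def using l(1) by (intro member_le_sum[of l "{..<?N}" "\<lambda>l. \<Sum>j<?N. \<bar>K $$ (j, l)\<bar>"]) (auto intro: sum_nonneg)
      finally show ?thesis .
    qed
    have qb: "\<bar>q u\<bar> \<le> (\<Sum>i<?N. \<bar>c (multi_indices m ! i)\<bar>)" if "u \<in> D" for u
      unfolding q using abs_monomial_le_1[OF that]
      by (intro order_trans[OF sum_abs] sum_mono) (simp add: abs_mult mult_left_le)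
    have "(\<integral>u. P u * q u * indicator D u \<partial>lborel)
        = (\<Sum>j<?N. \<Sum>i<?N. K $$ (j, l) * moment (multi_indices m ! j) (multi_indices m ! i) * c (multi_indices m ! i))"
      unfolding P_def q by (rule integral_sum_moment) auto
    also have "\<dots> = (\<Sum>i<?N. c (multi_indices m ! i) * (\<Sum>j<?N. moment (multi_indices m ! i) (multi_indices m ! j) * K $$ (j, l)))"
      unfolding sum_distrib_left by (subst sum.swap) (simp add: moment_commute mult_ac)
    also have "\<dots> = (\<Sum>i<?N. if i = l then c (multi_indices m ! i) else 0)"
      by (intro sum.cong refl) (use dual l in auto)
    also have "\<dots> = c \<alpha>" using l by simp
    finally have "\<bar>c \<alpha>\<bar> = \<bar>\<integral>u. P u * q u * indicator D u \<partial>lborel\<bar>" by simp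
    also have "\<dots> \<le> (\<integral>u. \<bar>P u * q u * indicator D u\<bar> \<partial>lborel)" by (rule integral_abs_bound)
    also have "\<dots> \<le> (\<integral>u. C * (\<bar>q u\<bar> * indicator D u) \<partial>lborel)"
    proof (rule integral_mono)
      have "integrable lborel (\<lambda>u. P u * q u * indicator D u)"
      proof (rule integrable_cusp_domain)
        show "\<bar>P u * q u\<bar> \<le> C * (\<Sum>i<?N. \<bar>c (multi_indices m ! i)\<bar>)" if "u \<in> D" for u
          unfolding abs_mult using P[OF that] qb[OF that] \<open>0 \<le> C\<close> by (intro mult_mono) auto
      qed measurable
      then show "integrable lborel (\<lambda>u. \<bar>P u * q u * indicator D u\<bar>)" by simp
      show "integrable lborel (\<lambda>u. C * (\<bar>q u\<bar> * indicator D u))"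
        by (intro integrable_mult_right integrable_cusp_domain[where c = "\<Sum>i<?N. \<bar>c (multi_indices m ! i)\<bar>"])
          (use qb in auto)
      show "\<bar>P u * q u * indicator D u\<bar> \<le> C * (\<bar>q u\<bar> * indicator D u)" for u
        using P[of u] by (auto simp: indicator_def abs_mult intro!: mult_right_mono)
    qed
    finally show ?thesis by (simp add: q_def)
  qed
  ultimately show ?thesis by (rule that)
qed

end

section \<open>Densities in the Hoelder class\<close>

lemma density_on_integrable:
  assumes "density_on D f" and [measurable]: "D \<in> sets borel"
  shows "(\<lambda>u. f u * indicator D u) \<in> borel_measurable borel"
    and "integrable lborel (\<lambda>u. f u * indicator D u)"
    and "(\<integral>u. f u * indicator D u \<partial>lborel) = 1"
proof -
  show meas[measurable]: "(\<lambda>u. f u * indicator D u) \<in> borel_measurable borel"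
    using assms by (simp add: density_on_def borel_measurable_restrict_space_iff mult.commute)
  have "(\<integral>\<^sup>+u. ennreal (f u * indicator D u) \<partial>lborel) = (\<integral>\<^sup>+u\<in>D. ennreal (f u) \<partial>lborel)"
    by (intro nn_integral_cong) (simp add: indicator_def)
  then have nn: "(\<integral>\<^sup>+u. ennreal (f u * indicator D u) \<partial>lborel) = 1"
    using assms(1) by (simp add: density_on_def)
  have nonneg: "AE u in lborel. 0 \<le> f u * indicator D u"
    using assms(1) by (intro AE_I2) (auto simp: density_on_def indicator_def)
  show "integrable lborel (\<lambda>u. f u * indicator D u)"
    by (rule integrableI_nonneg) (use nn nonneg in auto)
  show "(\<integral>u. f u * indicator D u \<partial>lborel) = 1"
    using nn nonneg by (subst integral_eq_nn_integral) auto
qed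

text \<open>The law of one observation.\<close>

lemma density_on_law:
  assumes "density_on D f" and [measurable]: "D \<in> sets borel"
  shows "density lborel (\<lambda>x. ennreal (f x) * indicator D x) = density lborel (\<lambda>x. ennreal (f x * indicator D x))"
    and "prob_space (density lborel (\<lambda>x. ennreal (f x) * indicator D x))"
proof -
  have eq: "(\<lambda>x. ennreal (f x) * indicator D x) = (\<lambda>x. ennreal (f x * indicator D x))"
    by (auto simp: indicator_def)
  then show "density lborel (\<lambda>x. ennreal (f x) * indicator D x) = density lborel (\<lambda>x. ennreal (f x * indicator D x))"
    by simp
  have [measurable]: "(\<lambda>u. f u * indicator D u) \<in> borel_measurable borel"
    by (rule density_on_integrable[OF assms])
  show "prob_space (density lborel (\<lambda>x. ennreal (f x) * indicator D x))"
  proof (rule prob_spaceI)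
    have "emeasure (density lborel (\<lambda>x. ennreal (f x * indicator D x))) UNIV
        = (\<integral>\<^sup>+x. ennreal (f x * indicator D x) \<partial>lborel)"
      by (subst emeasure_density) auto
    then show "emeasure (density lborel (\<lambda>x. ennreal (f x) * indicator D x))
        (space (density lborel (\<lambda>x. ennreal (f x) * indicator D x))) = 1"
      using assms(1) unfolding eq by (simp add: density_on_def flip: eq)
  qed
qed

lemma holder_degree_mono: "\<beta> \<le> s \<Longrightarrow> holder_degree \<beta> \<le> holder_degree s"
  unfolding holder_degree_def by (intro nat_mono diff_right_mono ceiling_mono)

lemma le_Suc_holder_degree:
  assumes "0 < \<beta>"
  shows "\<beta> \<le> real (Suc (holder_degree \<beta>))"
proof -
  have "1 \<le> \<lceil>\<beta>\<rceil>" using assms by simp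
  then have "real (Suc (holder_degree \<beta>)) = of_int \<lceil>\<beta>\<rceil>" by (simp add: holder_degree_def)
  then show ?thesis by simp
qed

context cusp
begin

lemma holder_class_cusp_domainD:
  assumes "f \<in> holder_class D (0, 0) 1 s L"
  obtains q where "density_on D f" "q \<in> poly_space (holder_degree s)"
    "\<And>u. u \<in> D \<Longrightarrow> \<bar>f u - q u\<bar> \<le> L * fst u powr s"
proof -
  from assms obtain q where q: "density_on D f" "q \<in> poly_space (holder_degree s)"
    "\<forall>u\<in>nbhd D (0, 0) 1. \<bar>f ((0, 0) + u) - q u\<bar> \<le> L * infnorm u powr s"
    by (auto simp: holder_class_def)
  have "\<bar>f u - q u\<bar> \<le> L * fst u powr s" if "u \<in> D" for u
    using q(3) that infnorm_cusp_domain[OF that] unfolding nbhd_cusp_domain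
    by (auto simp: zero_prod_def[symmetric] dest!: bspec)
  then show ?thesis using q that by blast
qed

text \<open>Membership in the class of smoothness \<open>s\<close> gives membership in every class of smoothness \<open>\<beta> \<le> s\<close>,
  with a constant that does not depend on the density or on \<open>\<beta>\<close>. The approximating polynomial is close
  to a density of total mass \<open>1\<close>, so its \<open>L\<^sup>1\<close> norm and hence its coefficients are bounded; its terms
  of degree at least \<open>\<beta>\<close> can then be moved into the remainder.\<close>

lemma holder_class_truncation:
  assumes s: "0 < s" and L: "0 < L"
  obtains A where "0 < A"
    "\<And>f u. f \<in> holder_class D (0, 0) 1 s L \<Longrightarrow> u \<in> D \<Longrightarrow> \<bar>f u\<bar> \<le> A"
    "\<And>f \<beta>. f \<in> holder_class D (0, 0) 1 s L \<Longrightarrow> 0 < \<beta> \<Longrightarrow> \<beta> \<le> s \<Longrightarrow>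
      \<exists>p\<in>poly_space (holder_degree \<beta>). \<forall>u\<in>D. \<bar>f u - p u\<bar> \<le> A * fst u powr \<beta>"
proof -
  let ?I = "\<lambda>m. {\<alpha>::nat \<times> nat. fst \<alpha> + snd \<alpha> \<le> m}"
  define M where "M = holder_degree s"
  obtain C where C: "0 \<le> C" "\<And>c \<alpha>. fst \<alpha> + snd \<alpha> \<le> M \<Longrightarrow> \<bar>c \<alpha>\<bar> \<le>
      C * (\<integral>u. \<bar>\<Sum>\<beta>\<in>?I M. c \<beta> * monomial \<beta> u\<bar> * indicator D u \<partial>lborel)"
    using coefficients_bounded_by_L1[of M] by blast
  define B where "B = C * (1 + L)"
  have B: "0 \<le> B" using C(1) L by (simp add: B_def)
  define A where "A = L + real (card (?I M)) * B"
  have A: "0 < A" using L B by (simp add: A_def add_pos_nonneg)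
  have coeffs: "\<exists>c. (\<forall>\<alpha>\<in>?I M. \<bar>c \<alpha>\<bar> \<le> B) \<and>
      (\<forall>u\<in>D. \<bar>f u - (\<Sum>\<alpha>\<in>?I M. c \<alpha> * monomial \<alpha> u)\<bar> \<le> L * fst u powr s)"
    if f: "f \<in> holder_class D (0, 0) 1 s L" for f
  proof -
    obtain q where q: "density_on D f" "q \<in> poly_space M" "\<And>u. u \<in> D \<Longrightarrow> \<bar>f u - q u\<bar> \<le> L * fst u powr s"
      using holder_class_cusp_domainD[OF f] by (auto simp: M_def)
    note fD = density_on_integrable[OF q(1) sets_cusp_domain]
    from q(2) obtain c where c: "q = (\<lambda>u. \<Sum>\<alpha>\<in>?I M. c \<alpha> * monomial \<alpha> u)" by (auto simp: poly_space_def)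
    have LD: "integrable lborel (\<lambda>u. L * indicator D u)"
      using emeasure_cusp_domain by (simp add: less_top)
    have "(\<integral>u. \<bar>q u\<bar> * indicator D u \<partial>lborel) \<le> (\<integral>u. f u * indicator D u + L * indicator D u \<partial>lborel)"
    proof (rule integral_mono)
      show "integrable lborel (\<lambda>u. f u * indicator D u + L * indicator D u)" using fD LD by simp
      show *: "\<bar>q u\<bar> * indicator D u \<le> f u * indicator D u + L * indicator D u" for u
      proof (cases "u \<in> D")
        case True
        have "fst u powr s \<le> 1" using cusp_domain_memD[OF True] s powr_mono2[of s "fst u" 1] by simp
        then have "L * fst u powr s \<le> L" using L by (simp add: mult_left_le)
        moreover have "0 \<le> f u" using q(1) True by (simp add: density_on_def)
        ultimately show ?thesis using q(3)[OF True] True by simp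
      qed simp
      have [measurable]: "q \<in> borel_measurable borel" using q(2) by (rule measurable_poly_space)
      show "integrable lborel (\<lambda>u. \<bar>q u\<bar> * indicator D u)"
      proof (rule Bochner_Integration.integrable_bound)
        show "integrable lborel (\<lambda>u. f u * indicator D u + L * indicator D u)" using fD LD by simp
        show "AE u in lborel. norm (\<bar>q u\<bar> * indicator D u) \<le> norm (f u * indicator D u + L * indicator D u)"
          using * by (intro AE_I2) (smt (verit, best) abs_ge_zero abs_mult abs_of_nonneg indicator_pos_le mult_nonneg_nonneg real_norm_def)
      qed simp
    qed
    also have "\<dots> = 1 + L * measure lborel D" using fD LD by simp
    also have "\<dots> \<le> 1 + L" using measure_cusp_domain_le L by (simp add: mult_left_le)
    finally have "(\<integral>u. \<bar>q u\<bar> * indicator D u \<partial>lborel) \<le> 1 + L" .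
    then have "\<bar>c \<alpha>\<bar> \<le> B" if "\<alpha> \<in> ?I M" for \<alpha>
      using C(2)[of \<alpha> c] that mult_left_mono[OF _ C(1)] unfolding B_def c by fastforce
    then show ?thesis using q(3) unfolding c by blast
  qed
  have bounded: "\<bar>f u\<bar> \<le> A" if f: "f \<in> holder_class D (0, 0) 1 s L" and u: "u \<in> D" for f u
  proof -
    obtain c where c: "\<forall>\<alpha>\<in>?I M. \<bar>c \<alpha>\<bar> \<le> B"
        "\<forall>u\<in>D. \<bar>f u - (\<Sum>\<alpha>\<in>?I M. c \<alpha> * monomial \<alpha> u)\<bar> \<le> L * fst u powr s"
      using coeffs[OF f] by blast
    have "\<bar>\<Sum>\<alpha>\<in>?I M. c \<alpha> * monomial \<alpha> u\<bar> \<le> (\<Sum>\<alpha>\<in>?I M. B)"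
    proof (intro order_trans[OF sum_abs] sum_mono)
      fix \<alpha> assume "\<alpha> \<in> ?I M"
      with c(1) have "\<bar>c \<alpha>\<bar> \<le> B" by (rule bspec)
      then have "\<bar>c \<alpha>\<bar> * \<bar>monomial \<alpha> u\<bar> \<le> B * 1"
        using abs_monomial_le_1[OF u] B by (intro mult_mono) simp_all
      then show "\<bar>c \<alpha> * monomial \<alpha> u\<bar> \<le> B" by (simp add: abs_mult)
    qed
    moreover have "L * fst u powr s \<le> L"
      using cusp_domain_memD[OF u] s powr_mono2[of s "fst u" 1] L by (simp add: mult_left_le)
    ultimately show ?thesis using c(2) u unfolding A_def by fastforce
  qed
  have trunc: "\<exists>p\<in>poly_space (holder_degree \<beta>). \<forall>u\<in>D. \<bar>f u - p u\<bar> \<le> A * fst u powr \<beta>"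
    if f: "f \<in> holder_class D (0, 0) 1 s L" and \<beta>: "0 < \<beta>" "\<beta> \<le> s" for f \<beta>
  proof -
    obtain c where c: "\<forall>\<alpha>\<in>?I M. \<bar>c \<alpha>\<bar> \<le> B"
        "\<forall>u\<in>D. \<bar>f u - (\<Sum>\<alpha>\<in>?I M. c \<alpha> * monomial \<alpha> u)\<bar> \<le> L * fst u powr s"
      using coeffs[OF f] by blast
    define m where "m = holder_degree \<beta>"
    have mM: "m \<le> M" unfolding m_def M_def by (rule holder_degree_mono) fact
    define p where "p u = (\<Sum>\<alpha>\<in>?I m. c \<alpha> * monomial \<alpha> u)" for u
    have "p \<in> poly_space (holder_degree \<beta>)" unfolding poly_space_def p_def m_def by blast
    moreover have "\<bar>f u - p u\<bar> \<le> A * fst u powr \<beta>" if u: "u \<in> D" for u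
    proof -
      note mem = cusp_domain_memD[OF u]
      have sub: "?I m \<subseteq> ?I M" using mM by auto
      have "(\<Sum>\<alpha>\<in>?I M. c \<alpha> * monomial \<alpha> u) - p u = (\<Sum>\<alpha>\<in>?I M - ?I m. c \<alpha> * monomial \<alpha> u)"
        unfolding p_def using sub by (simp add: sum_diff)
      also have "\<bar>\<dots>\<bar> \<le> (\<Sum>\<alpha>\<in>?I M - ?I m. B * fst u powr \<beta>)"
      proof (intro order_trans[OF sum_abs] sum_mono)
        fix \<alpha> assume \<alpha>: "\<alpha> \<in> ?I M - ?I m"
        have "fst u ^ (fst \<alpha> + snd \<alpha>) \<le> fst u powr \<beta>"
        proof (cases "fst u = 0")
          case True
          moreover have "fst \<alpha> + snd \<alpha> \<noteq> 0" using \<alpha> by auto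
          ultimately show ?thesis by (simp add: power_0_left)
        next
          case False
          have "\<beta> \<le> real (Suc m)" unfolding m_def by (rule le_Suc_holder_degree) fact
          also have "\<dots> \<le> real (fst \<alpha> + snd \<alpha>)" using \<alpha> by (simp del: of_nat_add)
          finally have "fst u powr real (fst \<alpha> + snd \<alpha>) \<le> fst u powr \<beta>"
            using mem by (intro powr_mono') auto
          then show ?thesis using mem False powr_realpow[of "fst u" "fst \<alpha> + snd \<alpha>"] by simp
        qed
        with abs_monomial_le[OF u, of \<alpha>] have "\<bar>monomial \<alpha> u\<bar> \<le> fst u powr \<beta>" by (rule order_trans)
        moreover have "\<bar>c \<alpha>\<bar> \<le> B" using bspec[OF c(1), of \<alpha>] \<alpha> by blast
        ultimately show "\<bar>c \<alpha> * monomial \<alpha> u\<bar> \<le> B * fst u powr \<beta>"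
          using B unfolding abs_mult by (intro mult_mono) simp_all
      qed
      also have "\<dots> = real (card (?I M - ?I m)) * (B * fst u powr \<beta>)" by simp
      also have "\<dots> \<le> real (card (?I M)) * (B * fst u powr \<beta>)"
        using B by (intro mult_right_mono of_nat_mono card_mono) auto
      finally have 1: "\<bar>(\<Sum>\<alpha>\<in>?I M. c \<alpha> * monomial \<alpha> u) - p u\<bar> \<le> real (card (?I M)) * B * fst u powr \<beta>"
        by (simp only: mult.assoc)
      have "fst u powr s \<le> fst u powr \<beta>" using mem \<beta> by (intro powr_mono') auto
      then have "L * fst u powr s \<le> L * fst u powr \<beta>" using L by simp
      with 1 c(2) u have "\<bar>f u - p u\<bar> \<le> real (card (?I M)) * B * fst u powr \<beta> + L * fst u powr \<beta>"
        by fastforce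
      then show ?thesis by (simp add: A_def algebra_simps)
    qed
    ultimately show ?thesis by blast
  qed
  show ?thesis using that[of A] A bounded trunc by blast
qed

end

section \<open>Upper bound for the risk\<close>

context cusp
begin

lemma dilation_inverse:
  assumes "0 < h"
  shows "dilation h (dilation (1 / h) u) = u" "dilation (1 / h) (dilation h u) = u"
  using assms by (auto simp: dilation_def powr_divide)

lemma local_poly_est_eq:
  "local_poly_est D (0, 0) m h n \<omega> = (\<Sum>i<n. scalar_prod (basis_vec D (0, 0) m h 0) (basis_vec D (0, 0) m h (\<omega> i))
      * kernel_weight D (0, 0) h (\<omega> i)) / real n"
  by (simp add: local_poly_est_def zero_prod_def[symmetric])

lemma measurable_local_poly_weight:
  assumes h: "0 < h" "h \<le> 1"
  shows "(\<lambda>u. scalar_prod (basis_vec D (0, 0) m h 0) (basis_vec D (0, 0) m h u) * kernel_weight D (0, 0) h u)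
    \<in> borel_measurable borel"
proof -
  obtain G A where G[measurable]: "G \<in> borel_measurable borel" and
    weight: "\<And>h v. 0 < h \<Longrightarrow> h \<le> 1 \<Longrightarrow>
      scalar_prod (basis_vec D (0, 0) m h 0) (basis_vec D (0, 0) m h (dilation h v))
        * kernel_weight D (0, 0) h (dilation h v)
      = h powr (- (k + 1)) * (G v * indicator D v)"
    by (rule equivalent_kernel[of m]) blast
  have "(\<lambda>u. scalar_prod (basis_vec D (0, 0) m h 0) (basis_vec D (0, 0) m h u) * kernel_weight D (0, 0) h u)
      = (\<lambda>u. h powr (- (k + 1)) * (G (dilation (1 / h) u) * indicator D (dilation (1 / h) u)))"
    using weight[OF h, of "dilation (1 / h) u" for u] h by (simp add: dilation_inverse)
  also have "\<dots> \<in> borel_measurable borel" by measurable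
  finally show ?thesis .
qed

lemma local_poly_est_measurable:
  assumes "0 < h" "h \<le> 1"
  shows "local_poly_est D (0, 0) m h n \<in> estimators n"
proof -
  have "(\<lambda>\<omega>. scalar_prod (basis_vec D (0, 0) m h 0) (basis_vec D (0, 0) m h (\<omega> i)) * kernel_weight D (0, 0) h (\<omega> i))
      \<in> borel_measurable (Pi\<^sub>M {..<n} (\<lambda>_. borel))" if "i \<in> {..<n}" for i
    using measurable_component_singleton[OF that] measurable_local_poly_weight[OF assms]
    by (rule measurable_compose)
  then show ?thesis
    unfolding estimators_def local_poly_est_eq[abs_def]
    by (intro borel_measurable_divide borel_measurable_const borel_measurable_sum)
qed

text \<open>A squared bias of order \<open>h\<^sup>2\<^sup>\<beta>\<close>, by polynomial reproduction, and a variance of order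
  \<open>1 / (n h\<^sup>k\<^sup>+\<^sup>1)\<close>, because the density is bounded and
  the window of bandwidth \<open>h\<close> has an area of order \<open>h\<^sup>k\<^sup>+\<^sup>1\<close>.\<close>

lemma local_poly_risk_bias_variance:
  assumes A: "0 < A"
  obtains C where "0 < C"
    "\<And>f p \<beta> h n. density_on D f \<Longrightarrow> (\<And>u. u \<in> D \<Longrightarrow> \<bar>f u\<bar> \<le> A) \<Longrightarrow> p \<in> poly_space m \<Longrightarrow>
      (\<And>u. u \<in> D \<Longrightarrow> \<bar>f u - p u\<bar> \<le> A * fst u powr \<beta>) \<Longrightarrow> 0 < \<beta> \<Longrightarrow> 0 < h \<Longrightarrow> h \<le> 1 \<Longrightarrow> 1 \<le> n \<Longrightarrow>
      risk D (0, 0) n (local_poly_est D (0, 0) m h n) f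
      \<le> ennreal (sqrt (C * (h powr (2 * \<beta>) + h powr (- (k + 1)) / real n)))"
proof -
  obtain G B where G[measurable]: "G \<in> borel_measurable borel" and B: "0 \<le> B" "\<And>v. v \<in> D \<Longrightarrow> \<bar>G v\<bar> \<le> B" and
    repro: "\<And>p. p \<in> poly_space m \<Longrightarrow> (\<integral>v. G v * p v * indicator D v \<partial>lborel) = p (0, 0)" and
    weight: "\<And>h v. 0 < h \<Longrightarrow> h \<le> 1 \<Longrightarrow>
      scalar_prod (basis_vec D (0, 0) m h 0) (basis_vec D (0, 0) m h (dilation h v))
        * kernel_weight D (0, 0) h (dilation h v)
      = h powr (- (k + 1)) * (G v * indicator D v)"
    by (rule equivalent_kernel[of m]) blast
  define C where "C = A * B\<^sup>2 + (B * A)\<^sup>2 + 1"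
  have C: "0 < C" "A * B\<^sup>2 \<le> C" "(B * A)\<^sup>2 \<le> C" using A by (auto simp: C_def add_nonneg_pos)
  have "risk D (0, 0) n (local_poly_est D (0, 0) m h n) f
      \<le> ennreal (sqrt (C * (h powr (2 * \<beta>) + h powr (- (k + 1)) / real n)))"
    if dens: "density_on D f" and fA: "\<And>u. u \<in> D \<Longrightarrow> \<bar>f u\<bar> \<le> A" and p: "p \<in> poly_space m"
      and fp: "\<And>u. u \<in> D \<Longrightarrow> \<bar>f u - p u\<bar> \<le> A * fst u powr \<beta>" and \<beta>: "0 < \<beta>"
      and h: "0 < h" "h \<le> 1" and n: "1 \<le> n"
    for f p \<beta> h n
  proof -
    define K where "K u = scalar_prod (basis_vec D (0, 0) m h 0) (basis_vec D (0, 0) m h u)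
        * kernel_weight D (0, 0) h u" for u
    have K[measurable]: "K \<in> borel_measurable borel"
      unfolding K_def[abs_def] by (rule measurable_local_poly_weight[OF h])
    have Kd: "K (dilation h v) = h powr (- (k + 1)) * (G v * indicator D v)" for v
      unfolding K_def by (rule weight[OF h])
    have Kb: "\<bar>K u\<bar> \<le> h powr (- (k + 1)) * B" for u
    proof -
      have "\<bar>G v * indicator D v\<bar> \<le> B" for v using B by (auto simp: indicator_def)
      then show ?thesis
        using Kd[of "dilation (1 / h) u"] h by (simp add: dilation_inverse abs_mult mult_left_mono)
    qed
    note f_meas[measurable] = density_on_integrable(1)[OF dens sets_cusp_domain]
    note law = density_on_law[OF dens sets_cusp_domain]
    have f0: "0 \<le> f u * indicator D u" for u
      using dens by (auto simp: density_on_def indicator_def)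
    define N where "N = density lborel (\<lambda>x. ennreal (f x * indicator D x))"
    have N: "prob_space N" using law by (simp add: N_def)
    have [measurable_cong, simp]: "sets N = sets borel" by (simp add: N_def)
    have expect: "(\<integral>u. g u \<partial>N) = h powr (k + 1) * (\<integral>v. g (dilation h v) * (f (dilation h v) * indicator D (dilation h v)) \<partial>lborel)"
      if [measurable]: "g \<in> borel_measurable borel" for g :: "real \<times> real \<Rightarrow> real"
    proof -
      have "(\<integral>u. g u \<partial>N) = (\<integral>u. g u * (f u * indicator D u) \<partial>lborel)"
        unfolding N_def using f0 by (subst integral_density) (auto simp: mult_ac)
      also have "\<dots> = h powr (k + 1) * (\<integral>v. g (dilation h v) * (f (dilation h v) * indicator D (dilation h v)) \<partial>lborel)"
        by (rule integral_dilation[OF h(1)]) measurable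
      finally show ?thesis .
    qed
    have hh: "h powr (k + 1) * h powr (- (k + 1)) = 1" using h by (simp add: powr_add[symmetric])
    have fd_meas[measurable]: "(\<lambda>v. f (dilation h v) * indicator D (dilation h v)) \<in> borel_measurable borel"
      by (rule measurable_compose[OF measurable_dilation f_meas])
    \<comment> \<open>the density in the coordinates of the undilated cusp\<close>
    define fh where "fh v = f (dilation h v) * indicator D (dilation h v)" for v
    have [measurable]: "fh \<in> borel_measurable borel" unfolding fh_def[abs_def] by measurable
    have fh: "fh v = f (dilation h v)" "0 \<le> fh v" "fh v \<le> A" if "v \<in> D" for v
      using dilation_in_cusp_domain[OF h that] fA[of "dilation h v"] f0[of "dilation h v"] by (auto simp: fh_def)
    have mean: "(\<integral>u. K u \<partial>N) = (\<integral>v. G v * fh v * indicator D v \<partial>lborel)"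
    proof -
      have "(\<integral>u. K u \<partial>N) = h powr (k + 1) * (\<integral>v. h powr (- (k + 1)) * (G v * fh v * indicator D v) \<partial>lborel)"
        unfolding expect[OF K] Kd fh_def by (simp add: mult_ac)
      also have "\<dots> = h powr (k + 1) * h powr (- (k + 1)) * (\<integral>v. G v * fh v * indicator D v \<partial>lborel)"
        by (simp only: integral_mult_right_zero mult.assoc)
      finally show ?thesis unfolding hh by simp
    qed
    define ph where "ph v = p (dilation h v)" for v
    have ph: "ph \<in> poly_space m" unfolding ph_def[abs_def] using poly_space_dilation[OF p h(1)] .
    note [measurable] = measurable_poly_space[OF ph]
    have diff: "\<bar>fh v - ph v\<bar> \<le> A * h powr \<beta>" if v: "v \<in> D" for v
    proof -
      have "\<bar>fh v - ph v\<bar> \<le> A * (h * fst v) powr \<beta>"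
        using fp[OF dilation_in_cusp_domain[OF h v]] by (simp add: fh[OF v] ph_def)
      also have "\<dots> \<le> A * h powr \<beta>"
        using A \<beta> h cusp_domain_memD[OF v] by (intro mult_left_mono powr_mono2) (auto simp: mult_left_le)
      finally show ?thesis .
    qed
    \<comment> \<open>at the origin the bound on the remainder is zero\<close>
    have zero: "f (0, 0) = p (0, 0)" using fp[OF zero_in_cusp_domain] by simp
    have bias: "\<bar>(\<integral>u. K u \<partial>N) - f (0, 0)\<bar> \<le> B * A * h powr \<beta>"
    proof -
      have i1: "integrable lborel (\<lambda>v. G v * fh v * indicator D v)"
      proof (rule integrable_cusp_domain)
        show "\<bar>G v * fh v\<bar> \<le> B * A" if "v \<in> D" for v
          unfolding abs_mult using B fh[OF that] that by (intro mult_mono) auto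
      qed measurable
      have i2: "integrable lborel (\<lambda>v. G v * (fh v - ph v) * indicator D v)"
      proof (rule integrable_cusp_domain)
        show "\<bar>G v * (fh v - ph v)\<bar> \<le> B * (A * h powr \<beta>)" if "v \<in> D" for v
          unfolding abs_mult using B diff[OF that] that by (intro mult_mono) auto
      qed measurable
      have "(\<integral>v. G v * fh v * indicator D v \<partial>lborel) - (\<integral>v. G v * (fh v - ph v) * indicator D v \<partial>lborel)
          = (\<integral>v. G v * ph v * indicator D v \<partial>lborel)"
        unfolding Bochner_Integration.integral_diff[OF i1 i2, symmetric] by (simp add: algebra_simps)
      also have "\<dots> = f (0, 0)" using repro[OF ph] by (simp add: ph_def zero dilation_def)
      finally have "(\<integral>u. K u \<partial>N) - f (0, 0) = (\<integral>v. G v * (fh v - ph v) * indicator D v \<partial>lborel)"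
        unfolding mean by simp
      moreover have "\<bar>\<integral>v. G v * (fh v - ph v) * indicator D v \<partial>lborel\<bar> \<le> B * (A * h powr \<beta>)"
      proof (rule abs_integral_cusp_domain_le)
        show "\<bar>G v * (fh v - ph v)\<bar> \<le> B * (A * h powr \<beta>)" if "v \<in> D" for v
          unfolding abs_mult using B diff[OF that] that by (intro mult_mono) auto
      qed (use A B in auto)
      ultimately show ?thesis by (simp add: mult.assoc)
    qed
    have second: "(\<integral>u. (K u)\<^sup>2 \<partial>N) \<le> h powr (- (k + 1)) * (A * B\<^sup>2)"
    proof -
      have "(\<integral>u. (K u)\<^sup>2 \<partial>N) = h powr (k + 1) * (\<integral>v. h powr (- (k + 1)) * h powr (- (k + 1)) * ((G v)\<^sup>2 * fh v * indicator D v) \<partial>lborel)"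
        by (subst expect) (auto simp: Kd fh_def power2_eq_square mult_ac indicator_def intro!: arg_cong[where f = "integral\<^sup>L lborel"])
      also have "\<dots> = h powr (k + 1) * h powr (- (k + 1)) * (h powr (- (k + 1)) * (\<integral>v. (G v)\<^sup>2 * fh v * indicator D v \<partial>lborel))"
        by (simp only: integral_mult_right_zero mult.assoc)
      also have "\<dots> = h powr (- (k + 1)) * (\<integral>v. (G v)\<^sup>2 * fh v * indicator D v \<partial>lborel)"
        unfolding hh by simp
      also have "\<dots> \<le> h powr (- (k + 1)) * (A * B\<^sup>2)"
      proof (intro mult_left_mono order_trans[OF abs_ge_self abs_integral_cusp_domain_le])
        show "\<bar>(G v)\<^sup>2 * fh v\<bar> \<le> A * B\<^sup>2" if "v \<in> D" for v
        proof -
          have "(G v)\<^sup>2 \<le> B\<^sup>2" using B(2)[OF that] B(1) by (simp add: abs_le_square_iff[symmetric])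
          then have "(G v)\<^sup>2 * fh v \<le> B\<^sup>2 * A" using fh[OF that] by (intro mult_mono) auto
          then show ?thesis using fh[OF that] by (simp add: mult.commute abs_mult)
        qed
      qed (use A B in auto)
      finally show ?thesis .
    qed
    have "(\<integral>\<^sup>+\<omega>. ennreal ((local_poly_est D (0, 0) m h n \<omega> - f (0, 0))\<^sup>2) \<partial>sample_law D n f)
        = (\<integral>\<^sup>+\<omega>. ennreal (((\<Sum>i<n. K (\<omega> i)) / real n - f (0, 0))\<^sup>2) \<partial>Pi\<^sub>M {..<n} (\<lambda>_. N))"
      by (simp add: sample_law_def law(1) N_def local_poly_est_eq K_def)
    also have "\<dots> \<le> ennreal ((\<integral>u. (K u)\<^sup>2 \<partial>N) / real n + ((\<integral>u. K u \<partial>N) - f (0, 0))\<^sup>2)"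
      by (rule sample_mean_sq_error[OF N _ Kb n]) measurable
    also have "\<dots> \<le> ennreal (C * (h powr (2 * \<beta>) + h powr (- (k + 1)) / real n))"
    proof (rule ennreal_leI)
      have "(\<integral>u. (K u)\<^sup>2 \<partial>N) / real n \<le> C * (h powr (- (k + 1)) / real n)"
      proof -
        have "h powr (- (k + 1)) * (A * B\<^sup>2) \<le> C * h powr (- (k + 1))"
          unfolding mult.commute[of "h powr (- (k + 1))"] by (intro mult_right_mono C(2)) simp
        with second show ?thesis by (simp add: divide_right_mono)
      qed
      moreover have "((\<integral>u. K u \<partial>N) - f (0, 0))\<^sup>2 \<le> C * h powr (2 * \<beta>)"
      proof -
        have "((\<integral>u. K u \<partial>N) - f (0, 0))\<^sup>2 \<le> (B * A * h powr \<beta>)\<^sup>2"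
          using bias power_mono[OF bias, of 2] by simp
        also have "\<dots> = (B * A)\<^sup>2 * h powr (2 * \<beta>)"
          using h by (simp add: power_mult_distrib powr_power mult.commute)
        also have "\<dots> \<le> C * h powr (2 * \<beta>)" using C(3) by (intro mult_right_mono) auto
        finally show ?thesis .
      qed
      ultimately show "(\<integral>u. (K u)\<^sup>2 \<partial>N) / real n + ((\<integral>u. K u \<partial>N) - f (0, 0))\<^sup>2
          \<le> C * (h powr (2 * \<beta>) + h powr (- (k + 1)) / real n)"
        by (simp add: distrib_left)
    qed
    finally have "risk D (0, 0) n (local_poly_est D (0, 0) m h n) f
        \<le> ennreal_sqrt (ennreal (C * (h powr (2 * \<beta>) + h powr (- (k + 1)) / real n)))"
      unfolding risk_def by (rule ennreal_sqrt_mono)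
    then show ?thesis using C(1) by (simp add: ennreal_sqrt_ennreal)
  qed
  then show ?thesis using C(1) by (intro that) blast+
qed

text \<open>The bandwidth at which \<open>h\<^sup>2\<^sup>\<beta>\<close> and \<open>1 / (n h\<^sup>k\<^sup>+\<^sup>1)\<close> are equal.\<close>

lemma optimal_bandwidth:
  assumes n: "1 \<le> n" and \<beta>: "0 < \<beta>"
  defines "h \<equiv> real n powr (- 1 / (2 * \<beta> + k + 1))"
  shows "0 < h" "h \<le> 1" "h powr (2 * \<beta>) = (real n powr (- \<beta> / (2 * \<beta> + k + 1)))\<^sup>2"
    "h powr (- (k + 1)) / real n = (real n powr (- \<beta> / (2 * \<beta> + k + 1)))\<^sup>2"
proof -
  have pos: "0 < 2 * \<beta> + k + 1" using \<beta> k_gt_1 by simp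
  show "0 < h" using n by (simp add: h_def)
  show "h \<le> 1" using n pos powr_mono[of "- 1 / (2 * \<beta> + k + 1)" 0 "real n"] by (simp add: h_def field_simps)
  have sq: "(real n powr (- \<beta> / (2 * \<beta> + k + 1)))\<^sup>2 = real n powr (- (2 * \<beta>) / (2 * \<beta> + k + 1))"
    using n by (simp add: powr_power)
  show "h powr (2 * \<beta>) = (real n powr (- \<beta> / (2 * \<beta> + k + 1)))\<^sup>2"
    unfolding sq h_def by (simp add: powr_powr)
  have "h powr (- (k + 1)) / real n = real n powr ((k + 1) / (2 * \<beta> + k + 1) - 1)"
  proof -
    have "- 1 / (2 * \<beta> + k + 1) * (- (k + 1)) = (k + 1) / (2 * \<beta> + k + 1)"
      using pos by (simp add: field_simps)
    then show ?thesis unfolding h_def powr_powr powr_diff using n by simp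
  qed
  also have "(k + 1) / (2 * \<beta> + k + 1) - 1 = - (2 * \<beta>) / (2 * \<beta> + k + 1)"
    using pos by (simp add: field_simps)
  finally show "h powr (- (k + 1)) / real n = (real n powr (- \<beta> / (2 * \<beta> + k + 1)))\<^sup>2"
    unfolding sq .
qed

lemma local_poly_risk_upper_bound:
  assumes s: "0 < s" and L: "0 < L"
  obtains C where "0 < C"
    "\<And>f \<beta> n. f \<in> holder_class D (0, 0) 1 s L \<Longrightarrow> 0 < \<beta> \<Longrightarrow> \<beta> \<le> s \<Longrightarrow> 1 \<le> n \<Longrightarrow>
      risk D (0, 0) n (local_poly_est D (0, 0) (holder_degree \<beta>) (real n powr (- 1 / (2 * \<beta> + k + 1))) n) f
      \<le> ennreal (C * real n powr (- \<beta> / (2 * \<beta> + k + 1)))"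
proof -
  obtain A where A: "0 < A"
    "\<And>f u. f \<in> holder_class D (0, 0) 1 s L \<Longrightarrow> u \<in> D \<Longrightarrow> \<bar>f u\<bar> \<le> A"
    "\<And>f \<beta>. f \<in> holder_class D (0, 0) 1 s L \<Longrightarrow> 0 < \<beta> \<Longrightarrow> \<beta> \<le> s \<Longrightarrow>
      \<exists>p\<in>poly_space (holder_degree \<beta>). \<forall>u\<in>D. \<bar>f u - p u\<bar> \<le> A * fst u powr \<beta>"
    by (rule holder_class_truncation[OF s L]) blast
  have "\<forall>m. \<exists>C. 0 < C \<and> (\<forall>f p \<beta> h n. density_on D f \<longrightarrow> (\<forall>u\<in>D. \<bar>f u\<bar> \<le> A) \<longrightarrow> p \<in> poly_space m \<longrightarrow>
      (\<forall>u\<in>D. \<bar>f u - p u\<bar> \<le> A * fst u powr \<beta>) \<longrightarrow> 0 < \<beta> \<longrightarrow> 0 < h \<longrightarrow> h \<le> 1 \<longrightarrow> 1 \<le> n \<longrightarrow>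
      risk D (0, 0) n (local_poly_est D (0, 0) m h n) f
      \<le> ennreal (sqrt (C * (h powr (2 * \<beta>) + h powr (- (k + 1)) / real n))))" (is "\<forall>m. \<exists>C. ?P m C")
  proof
    fix m
    show "\<exists>C. ?P m C" by (rule local_poly_risk_bias_variance[OF A(1), of m]) blast
  qed
  then obtain C where C: "\<And>m. ?P m (C m)" by metis
  \<comment> \<open>only finitely many degrees occur, so the constants can be added up\<close>
  define M where "M = holder_degree s"
  define E where "E = (\<Sum>m\<le>M. C m)"
  have CE: "C m \<le> E" if "m \<le> M" for m
    unfolding E_def using that C by (intro member_le_sum) (auto intro: less_imp_le)
  have E: "0 < E" using CE[of 0] C[of 0] by auto
  have "risk D (0, 0) n (local_poly_est D (0, 0) (holder_degree \<beta>) (real n powr (- 1 / (2 * \<beta> + k + 1))) n) f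
      \<le> ennreal (sqrt (2 * E) * real n powr (- \<beta> / (2 * \<beta> + k + 1)))"
    if f: "f \<in> holder_class D (0, 0) 1 s L" and \<beta>: "0 < \<beta>" "\<beta> \<le> s" and n: "1 \<le> n" for f \<beta> n
  proof -
    define h where "h = real n powr (- 1 / (2 * \<beta> + k + 1))"
    note h = optimal_bandwidth[OF n \<beta>(1), folded h_def]
    obtain p where p: "p \<in> poly_space (holder_degree \<beta>)" "\<forall>u\<in>D. \<bar>f u - p u\<bar> \<le> A * fst u powr \<beta>"
      using A(3)[OF f \<beta>] by blast
    have dens: "density_on D f" using f by (simp add: holder_class_def)
    define r where "r = real n powr (- \<beta> / (2 * \<beta> + k + 1))"
    have "risk D (0, 0) n (local_poly_est D (0, 0) (holder_degree \<beta>) h n) f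
        \<le> ennreal (sqrt (C (holder_degree \<beta>) * (h powr (2 * \<beta>) + h powr (- (k + 1)) / real n)))"
      using C[of "holder_degree \<beta>"] dens A(2)[OF f] p \<beta>(1) h(1,2) n by blast
    also have "h powr (2 * \<beta>) + h powr (- (k + 1)) / real n = 2 * r\<^sup>2"
      unfolding h(3,4) r_def by simp
    also have "ennreal (sqrt (C (holder_degree \<beta>) * (2 * r\<^sup>2))) \<le> ennreal (sqrt (2 * E) * r)"
    proof (rule ennreal_leI)
      have "C (holder_degree \<beta>) * (2 * r\<^sup>2) \<le> (2 * E) * r\<^sup>2"
        using CE[OF holder_degree_mono[OF \<beta>(2), folded M_def]] mult_right_mono[of _ E "2 * r\<^sup>2"] by simp
      then have "sqrt (C (holder_degree \<beta>) * (2 * r\<^sup>2)) \<le> sqrt ((2 * E) * r\<^sup>2)" by (rule real_sqrt_le_mono)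
      then show "sqrt (C (holder_degree \<beta>) * (2 * r\<^sup>2)) \<le> sqrt (2 * E) * r"
        by (simp add: real_sqrt_mult r_def)
    qed
    finally show ?thesis unfolding h_def r_def .
  qed
  then show ?thesis using E by (intro that[of "sqrt (2 * E)"]) auto
qed

end

section \<open>Lower bound for the minimax risk\<close>

context cusp
begin

lemma measure_cusp_domain_pos: "0 < measure lborel D"
proof -
  have "0 < moment (0, 0) (0, 0)"
    using moment_positive_definite[of 0 "\<lambda>_. 1"] by (simp add: multi_indices_def)
  then show ?thesis by (simp add: moment_def monomial_def)
qed

lemma emeasure_cusp_domain_truncated:
  assumes h: "0 < h" "h \<le> 1"
  shows "emeasure lborel {u \<in> D. fst u \<le> h} = ennreal (h powr (k + 1) * measure lborel D)"
proof -
  have [measurable]: "{u \<in> D. fst u \<le> h} \<in> sets borel"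
  proof -
    have "closed {u :: real \<times> real. fst u \<le> h}"
      by (intro closed_Collect_le continuous_intros)
    then have "D \<inter> {u. fst u \<le> h} \<in> sets borel" by auto
    then show ?thesis by (simp add: Int_def)
  qed
  have "indicator {u \<in> D. fst u \<le> h} (dilation h v) = (indicator D v :: ennreal)" for v
    using dilation_in_cusp_domain_iff[OF h, of v] by (simp add: indicator_def)
  then have "emeasure lborel {u \<in> D. fst u \<le> h} = ennreal (h powr (k + 1)) * emeasure lborel D"
    using nn_integral_dilation[OF h(1), of "indicator {u \<in> D. fst u \<le> h}"] by simp
  then show ?thesis by (simp add: emeasure_cusp_domain ennreal_mult)
qed

lemma nn_integral_step:
  assumes h: "0 < h" "h \<le> 1" and c: "0 \<le> c" "0 \<le> c'"
  shows "(\<integral>\<^sup>+u. ennreal (if fst u \<le> h then c else c') * indicator D u \<partial>lborel)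
    = ennreal ((c * h powr (k + 1) + c' * (1 - h powr (k + 1))) * measure lborel D)"
proof -
  let ?E = "{u \<in> D. fst u \<le> h}"
  have E[measurable]: "?E \<in> sets borel"
    using emeasure_cusp_domain_truncated[OF h] h measure_cusp_domain_pos
    by (metis emeasure_notin_sets ennreal_eq_0_iff less_eq_real_def linorder_not_less mult_pos_pos powr_gt_zero sets_lborel)
  have p: "h powr (k + 1) \<le> 1" using h k_gt_1 powr_mono2[of "k + 1" h 1] by simp
  have "emeasure lborel (D - ?E) = emeasure lborel D - emeasure lborel ?E"
    by (rule emeasure_Diff) (auto simp: emeasure_cusp_domain_truncated[OF h])
  also have "\<dots> = ennreal (measure lborel D - h powr (k + 1) * measure lborel D)"
    unfolding emeasure_cusp_domain emeasure_cusp_domain_truncated[OF h]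
    by (rule ennreal_minus) simp
  also have "measure lborel D - h powr (k + 1) * measure lborel D = (1 - h powr (k + 1)) * measure lborel D"
    by (simp add: algebra_simps)
  finally have DE: "emeasure lborel (D - ?E) = ennreal ((1 - h powr (k + 1)) * measure lborel D)" .
  have "(\<integral>\<^sup>+u. ennreal (if fst u \<le> h then c else c') * indicator D u \<partial>lborel)
      = (\<integral>\<^sup>+u. ennreal c * indicator ?E u + ennreal c' * indicator (D - ?E) u \<partial>lborel)"
    by (intro nn_integral_cong) (auto simp: indicator_def)
  also have "\<dots> = ennreal c * emeasure lborel ?E + ennreal c' * emeasure lborel (D - ?E)"
    by (subst nn_integral_add) (auto simp: nn_integral_cmult_indicator)
  also have "\<dots> = ennreal (c * (h powr (k + 1) * measure lborel D) + c' * ((1 - h powr (k + 1)) * measure lborel D))"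
    unfolding DE emeasure_cusp_domain_truncated[OF h] using c p by (simp add: ennreal_mult)
  finally show ?thesis by (simp add: algebra_simps)
qed

lemma measurable_step[measurable]:
  "(\<lambda>u :: real \<times> real. if fst u \<le> h then c else c' :: real) \<in> borel_measurable borel"
proof -
  have "(\<lambda>u :: real \<times> real. if fst u \<le> h then c else c' :: real) \<in> borel_measurable (borel \<Otimes>\<^sub>M borel)"
    by measurable
  then show ?thesis by (simp only: borel_prod)
qed

text \<open>For \<open>s \<le> 1\<close> the Hoelder condition only compares with the value at the origin. A density
  with one jump, of size at most \<open>L h\<^sup>s\<close> and at distance \<open>h\<close> from the origin, therefore satisfies it.\<close>

lemma step_in_holder_class:
  assumes s: "0 < s" "s \<le> 1" and h: "0 < h" "h \<le> 1" and c: "0 \<le> c" "0 \<le> c'"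
    and int: "(c * h powr (k + 1) + c' * (1 - h powr (k + 1))) * measure lborel D = 1"
    and L: "\<bar>c' - c\<bar> \<le> L * h powr s"
  shows "(\<lambda>u. if fst u \<le> h then c else c') \<in> holder_class D (0, 0) 1 s L"
proof -
  have L0: "0 \<le> L"
  proof (rule ccontr)
    assume "\<not> 0 \<le> L"
    then have "L * h powr s < 0" using h by (simp add: mult_neg_pos)
    with L show False by linarith
  qed
  have "\<lceil>s\<rceil> = 1" using s by (simp add: ceiling_eq_iff)
  then have deg: "holder_degree s = 0" by (simp add: holder_degree_def)
  have "density_on D (\<lambda>u. if fst u \<le> h then c else c')"
    unfolding density_on_def using c nn_integral_step[OF h c] int
    by (auto intro!: measurable_restrict_space1)
  moreover have "(\<lambda>_. c) \<in> poly_space 0"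
  proof -
    have "{\<alpha>::nat \<times> nat. fst \<alpha> + snd \<alpha> \<le> 0} = {(0, 0)}" by auto
    then show ?thesis unfolding poly_space_def mem_Collect_eq
      by (intro exI[of _ "\<lambda>_. c"]) (simp add: monomial_def)
  qed
  moreover have "\<bar>(if fst ((0, 0) + u) \<le> h then c else c') - c\<bar> \<le> L * infnorm u powr s" if "u \<in> D" for u
  proof (cases "fst u \<le> h")
    case False
    then have "h powr s \<le> fst u powr s" using h s by (intro powr_mono2) auto
    then have "L * h powr s \<le> L * fst u powr s" using L0 by (intro mult_left_mono)
    then show ?thesis using L False infnorm_cusp_domain[OF that] by (simp add: zero_prod_def[symmetric])
  qed (use L0 in \<open>simp add: zero_prod_def[symmetric]\<close>)
  ultimately show ?thesis
    unfolding holder_class_def nbhd_cusp_domain deg mem_Collect_eq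
    by (intro conjI bexI[of _ "\<lambda>_. c"] ballI)
qed

text \<open>The two hypotheses are the uniform density and the density that is larger by \<open>\<delta>\<close>, of order \<open>h\<^sup>s\<close>,
  where \<open>x \<le> h\<close> and smaller by a constant elsewhere. Their chi-square divergence is at most of order
  \<open>\<delta>\<^sup>2 h\<^sup>k\<^sup>+\<^sup>1\<close>, that is, of order \<open>1 / n\<close> for \<open>h\<close> of order \<open>n powr (- 1 / (2 * s + k + 1))\<close>.\<close>

lemma minimax_lower_bound:
  assumes s: "0 < s" "s \<le> 1" and L: "0 < L"
  obtains c where "0 < c"
    "\<And>n. 1 \<le> n \<Longrightarrow> ennreal (c * real n powr (- s / (2 * s + k + 1)))
      \<le> minimax_risk D (0, 0) (holder_class D (0, 0) 1 s L) n"
proof -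
  let ?F = "holder_class D (0, 0) 1 s L" and ?V = "measure lborel D"
  note V = measure_cusp_domain_pos measure_cusp_domain_le
  \<comment> \<open>\<open>a \<le> L / 2\<close> leaves room for the compensation in the Hoelder condition, and \<open>a \<le> 1\<close> keeps the
    perturbed density nonnegative\<close>
  define a where "a = min (L / 2) 1"
  have a: "0 < a" "a \<le> 1" "2 * a \<le> L" using L by (auto simp: a_def)
  define c where "c = a * (1 / 2) powr s / 7"
  have "0 < c" using a by (simp add: c_def)
  moreover have "ennreal (c * real n powr (- s / (2 * s + k + 1))) \<le> minimax_risk D (0, 0) ?F n" if n: "1 \<le> n" for n
  proof -
    define d where "d = 2 * s + k + 1"
    have d: "0 < d" "1 \<le> d" using s k_gt_1 by (auto simp: d_def)
    \<comment> \<open>the factor \<open>1 / 2\<close> makes \<open>h\<^sup>k\<^sup>+\<^sup>1 \<le> 1 / 2\<close> and the chi-square divergence at most \<open>1 / n\<close>\<close>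
    define h where "h = 1 / 2 * real n powr (- 1 / d)"
    have "real n powr (- 1 / d) \<le> 1" using n d powr_mono[of "- 1 / d" 0 "real n"] by (simp add: field_simps)
    then have h: "0 < h" "h \<le> 1 / 2" using n by (auto simp: h_def)
    then have h1: "h \<le> 1" by simp
    \<comment> \<open>the share of the cusp on which \<open>x \<le> h\<close>\<close>
    define p where "p = h powr (k + 1)"
    have p: "0 < p" "p \<le> 1 / 2"
    proof -
      have "h powr (k + 1) \<le> h powr 1" using h k_gt_1 by (intro powr_mono') auto
      then show "0 < p" "p \<le> 1 / 2" using h by (auto simp: p_def)
    qed
    have hd: "real n * (2 * h powr d) \<le> 1"
    proof -
      have "h powr d = (1 / 2) powr d * (real n powr (- 1 / d)) powr d"
        unfolding h_def by (rule powr_mult)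
      also have "(real n powr (- 1 / d)) powr d = 1 / real n"
        unfolding powr_powr using d n by (simp add: powr_minus_divide)
      finally have eq: "real n * (2 * h powr d) = 2 * (1 / 2) powr d" using n by simp
      have "(1 / 2 :: real) powr d \<le> (1 / 2) powr 1" using d by (intro powr_mono') auto
      then show ?thesis unfolding eq by simp
    qed
    define \<delta> where "\<delta> = a * h powr s"
    have \<delta>: "0 < \<delta>" "\<delta> \<le> 1"
    proof -
      show "0 < \<delta>" using a h by (simp add: \<delta>_def)
      have "h powr s \<le> 1" using h s powr_mono2[of s h 1] by simp
      then show "\<delta> \<le> 1" unfolding \<delta>_def using a by (simp add: mult_le_one)
    qed
    \<comment> \<open>chosen so that both densities have the same total mass\<close>
    define b where "b = \<delta> * p / (1 - p)"
    have b: "0 \<le> b" "b \<le> \<delta>" "b * (1 - p) = \<delta> * p"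
    proof -
      show "0 \<le> b" using \<delta> p by (simp add: b_def)
      have "\<delta> * p \<le> \<delta> * (1 - p)" using \<delta> p by (intro mult_left_mono) auto
      then show "b \<le> \<delta>" using p by (simp add: b_def divide_le_eq)
      show "b * (1 - p) = \<delta> * p" using p by (simp add: b_def)
    qed
    have Vb: "?V * b \<le> 1"
      using V b \<delta> mult_le_one[of "?V" b] by linarith
    \<comment> \<open>the uniform density, written as a step function with both values equal\<close>
    define f0 :: "real \<times> real \<Rightarrow> real" where "f0 u = (if fst u \<le> h then 1 / ?V else 1 / ?V)" for u
    define f1 :: "real \<times> real \<Rightarrow> real" where "f1 u = (if fst u \<le> h then 1 / ?V + \<delta> else 1 / ?V - b)" for u
    \<comment> \<open>the likelihood ratio of \<open>f1\<close> to \<open>f0\<close>\<close>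
    define \<rho> :: "real \<times> real \<Rightarrow> real" where "\<rho> u = (if fst u \<le> h then 1 + ?V * \<delta> else 1 - ?V * b)" for u
    have [measurable]: "\<rho> \<in> borel_measurable borel" unfolding \<rho>_def[abs_def] by measurable
    have \<rho>0: "0 \<le> \<rho> u" for u using Vb V \<delta> by (auto simp: \<rho>_def)
    have f1\<rho>: "f1 u = 1 / ?V * \<rho> u" for u using V by (simp add: f1_def \<rho>_def field_simps)
    have f0: "f0 \<in> ?F"
      unfolding f0_def using V L h
      by (intro step_in_holder_class[OF s h(1) h1]) (auto simp: field_simps)
    have f1: "f1 \<in> ?F"
      unfolding f1_def
    proof (rule step_in_holder_class[OF s h(1) h1])
      show "0 \<le> 1 / ?V + \<delta>" using V \<delta> by simp
      show "0 \<le> 1 / ?V - b" using Vb V by (simp add: field_simps)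
      have "(1 / ?V + \<delta>) * p + (1 / ?V - b) * (1 - p) = 1 / ?V + (\<delta> * p - b * (1 - p))"
        by (simp add: ring_distribs diff_divide_distrib)
      also have "\<dots> = 1 / ?V" unfolding b(3) by simp
      finally have total: "(1 / ?V + \<delta>) * p + (1 / ?V - b) * (1 - p) = 1 / ?V" .
      show "((1 / ?V + \<delta>) * h powr (k + 1) + (1 / ?V - b) * (1 - h powr (k + 1))) * ?V = 1"
        unfolding p_def[symmetric] total using V(1) by simp
      have "\<delta> + b \<le> 2 * a * h powr s" using b by (simp add: \<delta>_def)
      also have "\<dots> \<le> L * h powr s" using a by (intro mult_right_mono) auto
      finally show "\<bar>1 / ?V - b - (1 / ?V + \<delta>)\<bar> \<le> L * h powr s" using b \<delta> by simp
    qed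
    define N where "N = density lborel (\<lambda>x. ennreal (f0 x) * indicator D x)"
    have N: "prob_space N"
      unfolding N_def by (rule density_on_law) (use f0 in \<open>auto simp: holder_class_def\<close>)
    have [measurable_cong, simp]: "sets N = sets borel" by (simp add: N_def)
    have [measurable]: "f0 \<in> borel_measurable borel" unfolding f0_def[abs_def] by measurable
    have N1: "density lborel (\<lambda>x. ennreal (f1 x) * indicator D x) = density N \<rho>"
      unfolding N_def
      by (subst density_density_eq)
        (use V \<rho>0 in \<open>auto simp: f1\<rho> f0_def ennreal_mult[symmetric] indicator_def intro!: arg_cong[where f = "density lborel"]\<close>)
    have prob1: "prob_space (density N \<rho>)"
      unfolding N1[symmetric] by (rule density_on_law) (use f1 in \<open>auto simp: holder_class_def\<close>)
    have \<rho>2: "(\<integral>\<^sup>+u. ennreal ((\<rho> u)\<^sup>2) \<partial>N) \<le> ennreal (1 + 2 * h powr d)"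
    proof -
      have "(\<integral>\<^sup>+u. ennreal ((\<rho> u)\<^sup>2) \<partial>N)
          = (\<integral>\<^sup>+u. ennreal (if fst u \<le> h then (1 + ?V * \<delta>)\<^sup>2 / ?V else (1 - ?V * b)\<^sup>2 / ?V) * indicator D u \<partial>lborel)"
        unfolding N_def using V
        by (subst nn_integral_density)
          (auto simp: f0_def \<rho>_def indicator_def ennreal_mult[symmetric] intro!: nn_integral_cong)
      also have "\<dots> = ennreal (((1 + ?V * \<delta>)\<^sup>2 / ?V * p + (1 - ?V * b)\<^sup>2 / ?V * (1 - p)) * ?V)"
        unfolding p_def using V by (intro nn_integral_step[OF h(1) h1]) auto
      also have "((1 + ?V * \<delta>)\<^sup>2 / ?V * p + (1 - ?V * b)\<^sup>2 / ?V * (1 - p)) * ?V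
          = (1 + ?V * \<delta>)\<^sup>2 * p + (1 - ?V * b)\<^sup>2 * (1 - p)"
        using V by (simp add: field_simps)
      also have "\<dots> = 1 + 2 * ?V * (\<delta> * p - b * (1 - p)) + ?V\<^sup>2 * (\<delta>\<^sup>2 * p + b * (b * (1 - p)))"
        by (simp add: power2_eq_square algebra_simps)
      also have "\<dots> = 1 + ?V\<^sup>2 * (\<delta>\<^sup>2 * p + b * (\<delta> * p))" unfolding b(3) by simp
      finally have second_moment: "(\<integral>\<^sup>+u. ennreal ((\<rho> u)\<^sup>2) \<partial>N) = ennreal (1 + ?V\<^sup>2 * (\<delta>\<^sup>2 * p + b * (\<delta> * p)))" .
      have "?V\<^sup>2 * (\<delta>\<^sup>2 * p + b * (\<delta> * p)) \<le> 1 * (\<delta>\<^sup>2 * p + b * (\<delta> * p))"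
        using V b \<delta> p by (intro mult_right_mono) (auto simp: power_le_one)
      also have "1 * (\<delta>\<^sup>2 * p + b * (\<delta> * p)) \<le> 2 * (\<delta>\<^sup>2 * p)"
      proof -
        have "b * (\<delta> * p) \<le> \<delta> * (\<delta> * p)" using b \<delta> p by (intro mult_right_mono) auto
        then show ?thesis by (simp add: power2_eq_square)
      qed
      also have "2 * (\<delta>\<^sup>2 * p) \<le> 2 * h powr d"
      proof -
        have "\<delta>\<^sup>2 \<le> (h powr s)\<^sup>2" unfolding \<delta>_def using a by (intro power_mono) (auto intro: mult_left_le_one_le)
        then have "\<delta>\<^sup>2 * p \<le> (h powr s)\<^sup>2 * p" using p by simp
        moreover have "(h powr s)\<^sup>2 * p = h powr d"
          using h by (simp add: p_def d_def powr_power powr_add[symmetric] algebra_simps)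
        ultimately show ?thesis by simp
      qed
      finally show ?thesis unfolding second_moment by (intro ennreal_leI add_left_mono)
    qed
    have \<Delta>: "c * real n powr (- s / (2 * s + k + 1)) \<le> sqrt ((f0 (0, 0) - f1 (0, 0))\<^sup>2 / 48)"
    proof -
      have "h powr s = (1 / 2) powr s * real n powr (- s / d)"
        unfolding h_def by (subst powr_mult) (auto simp: powr_powr)
      then have eq: "c * real n powr (- s / (2 * s + k + 1)) = \<delta> / 7"
        by (simp add: c_def \<delta>_def d_def)
      \<comment> \<open>\<open>48 \<le> 7\<^sup>2\<close>\<close>
      have "(\<delta> / 7)\<^sup>2 \<le> (f0 (0, 0) - f1 (0, 0))\<^sup>2 / 48"
        using h by (simp add: f0_def f1_def power_divide divide_left_mono)
      then show ?thesis unfolding eq by (rule real_le_rsqrt)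
    qed
    show ?thesis
      unfolding minimax_risk_def
    proof (rule INF_greatest)
      fix g assume "g \<in> estimators n"
      then have g: "g \<in> borel_measurable (Pi\<^sub>M {..<n} (\<lambda>_. N))"
        by (simp add: estimators_def cong: measurable_cong_sets sets_PiM_cong)
      have "ennreal ((f0 (0, 0) - f1 (0, 0))\<^sup>2 / 48) \<le> (\<integral>\<^sup>+\<omega>. ennreal ((g \<omega> - f0 (0, 0))\<^sup>2) \<partial>sample_law D n f0) \<or>
          ennreal ((f0 (0, 0) - f1 (0, 0))\<^sup>2 / 48) \<le> (\<integral>\<^sup>+\<omega>. ennreal ((g \<omega> - f1 (0, 0))\<^sup>2) \<partial>sample_law D n f1)"
        unfolding sample_law_def N1 N_def[symmetric]
        by (rule two_point_sample_lower_bound[OF N _ g \<rho>0 prob1 \<rho>2 _ hd]) auto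
      then have "\<exists>f\<in>?F. ennreal (sqrt ((f0 (0, 0) - f1 (0, 0))\<^sup>2 / 48)) \<le> risk D (0, 0) n g f"
        using f0 f1 ennreal_sqrt_mono[of "ennreal ((f0 (0, 0) - f1 (0, 0))\<^sup>2 / 48)"]
        unfolding risk_def by (auto simp: ennreal_sqrt_ennreal)
      then show "ennreal (c * real n powr (- s / (2 * s + k + 1))) \<le> (SUP f\<in>?F. risk D (0, 0) n g f)"
        using \<Delta> by (meson SUP_upper ennreal_leI order_trans)
    qed
  qed
  ultimately show ?thesis by (rule that)
qed

end

section \<open>The rate exponent and the minimax rate\<close>

lemma ratio_increasing:
  fixes \<beta> \<beta>' c k :: real
  assumes "0 < \<beta>" "\<beta> \<le> \<beta>'" "0 \<le> c" "0 < k"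
  shows "(\<beta> - c) / (2 * \<beta> + k + 1) \<le> (\<beta>' - c) / (2 * \<beta>' + k + 1)"
proof -
  have "0 \<le> (\<beta>' - \<beta>) * (k + 1 + 2 * c)" using assms by (intro mult_nonneg_nonneg) auto
  then have "(\<beta> - c) * (2 * \<beta>' + k + 1) \<le> (\<beta>' - c) * (2 * \<beta> + k + 1)" by (simp add: algebra_simps)
  then show ?thesis using assms by (simp add: divide_le_eq pos_le_divide_eq mult.commute)
qed

text \<open>The rate exponent is increasing on the intervals on which \<open>\<lceil>\<beta>\<rceil>\<close> is constant, so its maximum is
  attained at \<open>s\<close> or at an integer.\<close>

lemma rate_exponent_has_arg_max:
  assumes k: "1 < k" and s: "0 < s"
  shows "\<exists>sk. is_arg_max (rate_exponent k) (\<lambda>\<beta>. \<beta> \<in> {0<..s}) sk"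
proof -
  define T where "T = (\<lambda>j. min (real j) s) ` {1..nat \<lceil>s\<rceil>}"
  have "1 \<le> nat \<lceil>s\<rceil>" using s by linarith
  then have T: "finite T" "T \<noteq> {}" by (auto simp: T_def)
  have TS: "T \<subseteq> {0<..s}" using s by (auto simp: T_def)
  obtain x where x: "x \<in> T" "\<forall>y\<in>T. rate_exponent k y \<le> rate_exponent k x"
  proof -
    have "Max (rate_exponent k ` T) \<in> rate_exponent k ` T" using T by (intro Max_in) auto
    then obtain x where "x \<in> T" "rate_exponent k x = Max (rate_exponent k ` T)" by auto
    then show thesis using that[of x] T by auto
  qed
  have "rate_exponent k \<beta> \<le> rate_exponent k x" if \<beta>: "\<beta> \<in> {0<..s}" for \<beta>
  proof -
    \<comment> \<open>the right end point of the interval that contains \<open>\<beta>\<close>\<close>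
    define \<beta>' where "\<beta>' = min (of_int \<lceil>\<beta>\<rceil>) s"
    have pos: "1 \<le> \<lceil>\<beta>\<rceil>" using \<beta> by simp
    have le: "\<beta> \<le> \<beta>'" using \<beta> by (auto simp: \<beta>'_def)
    have "\<lceil>\<beta>'\<rceil> \<le> \<lceil>\<beta>\<rceil>" unfolding ceiling_le_iff by (simp add: \<beta>'_def)
    then have ceil: "\<lceil>\<beta>'\<rceil> = \<lceil>\<beta>\<rceil>" using ceiling_mono[OF le] by linarith
    have "\<beta>' = min (real (nat \<lceil>\<beta>\<rceil>)) s" using pos by (simp add: \<beta>'_def)
    moreover have "nat \<lceil>\<beta>\<rceil> \<in> {1..nat \<lceil>s\<rceil>}"
    proof -
      have "1 \<le> nat \<lceil>\<beta>\<rceil>" using pos by linarith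
      moreover have "nat \<lceil>\<beta>\<rceil> \<le> nat \<lceil>s\<rceil>" using \<beta> by (intro nat_mono ceiling_mono) auto
      ultimately show ?thesis unfolding atLeastAtMost_iff by blast
    qed
    ultimately have "\<beta>' \<in> T" unfolding T_def by blast
    have "0 \<le> 2 * (of_int \<lceil>\<beta>\<rceil> - 1) * (k - 1)" using pos k by (intro mult_nonneg_nonneg) auto
    then have "rate_exponent k \<beta> \<le> rate_exponent k \<beta>'"
      unfolding rate_exponent_def ceil using \<beta> le k by (intro ratio_increasing) auto
    also have "\<dots> \<le> rate_exponent k x" using x(2) \<open>\<beta>' \<in> T\<close> by blast
    finally show ?thesis .
  qed
  then show ?thesis using x(1) TS by (intro exI[of _ x]) (auto simp: is_arg_max_linorder)
qed

lemma rate_exponent_le: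
  assumes "1 < k" "0 < \<beta>"
  shows "rate_exponent k \<beta> \<le> \<beta> / (2 * \<beta> + k + 1)"
proof -
  have "1 \<le> \<lceil>\<beta>\<rceil>" using assms by simp
  then have "0 \<le> 2 * (of_int \<lceil>\<beta>\<rceil> - 1) * (k - 1)" using assms by (intro mult_nonneg_nonneg) auto
  then show ?thesis unfolding rate_exponent_def using assms by (intro divide_right_mono) auto
qed

lemma rate_exponent_le_1:
  assumes "0 < s" "s \<le> 1"
  shows "rate_exponent k s = s / (2 * s + k + 1)"
proof -
  have "\<lceil>s\<rceil> = 1" using assms by (simp add: ceiling_eq_iff)
  then show ?thesis by (simp add: rate_exponent_def)
qed

lemma asymp_leI:
  assumes "\<And>n. 1 \<le> n \<Longrightarrow> 0 < v n" "\<And>n. 1 \<le> n \<Longrightarrow> u n \<le> v n * ennreal C"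
  shows "asymp_le u v"
proof -
  have "limsup (\<lambda>n. u n / v n) \<le> ennreal C"
    by (intro Limsup_bounded eventually_sequentiallyI[of 1] divide_le_posI_ennreal assms)
  then show ?thesis unfolding asymp_le_def by (rule le_less_trans) simp
qed

theorem proposition4p6:
  fixes k s L :: real
  assumes "k > 1" and "s > 0" and "L > 0"
  defines "D \<equiv> cusp_domain k"
    and "F \<equiv> holder_class (cusp_domain k) (0, 0) 1 s L"
  shows "(\<exists>sk. is_arg_max (rate_exponent k) (\<lambda>\<beta>. \<beta> \<in> {0<..s}) sk) \<and>
    (\<exists>C>0. \<forall>sk. is_arg_max (rate_exponent k) (\<lambda>\<beta>. \<beta> \<in> {0<..s}) sk \<longrightarrow>
       (\<forall>f\<in>F. \<forall>n\<ge>1.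
          risk D (0, 0) n
            (local_poly_est D (0, 0) (holder_degree sk) (real n powr (- 1 / (2 * sk + k + 1))) n) f
          \<le> ennreal (C * real n powr (- rate_exponent k sk)))) \<and>
    (s \<le> 1 \<longrightarrow>
       (\<exists>c>0. \<forall>n\<ge>1. ennreal (c * real n powr (- rate_exponent k s))
                     \<le> minimax_risk D (0, 0) F n) \<and>
       is_minimax_rate D (0, 0) F (\<lambda>n. real n powr (- s / (2 * s + k + 1))))"
proof -
  interpret cusp k by standard fact
  obtain C where C: "0 < C" and upper: "\<And>f \<beta> n. f \<in> F \<Longrightarrow> 0 < \<beta> \<Longrightarrow> \<beta> \<le> s \<Longrightarrow> 1 \<le> n \<Longrightarrow>
      risk D (0, 0) n (local_poly_est D (0, 0) (holder_degree \<beta>) (real n powr (- 1 / (2 * \<beta> + k + 1))) n) f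
      \<le> ennreal (C * real n powr (- \<beta> / (2 * \<beta> + k + 1)))"
    unfolding D_def F_def by (rule local_poly_risk_upper_bound[OF assms(2,3)]) blast
  have part1: "risk D (0, 0) n (local_poly_est D (0, 0) (holder_degree sk) (real n powr (- 1 / (2 * sk + k + 1))) n) f
      \<le> ennreal (C * real n powr (- rate_exponent k sk))"
    if sk: "is_arg_max (rate_exponent k) (\<lambda>\<beta>. \<beta> \<in> {0<..s}) sk" and f: "f \<in> F" and n: "1 \<le> n" for sk f n
  proof -
    have sk': "0 < sk" "sk \<le> s" using sk by (auto simp: is_arg_max_def)
    have "real n powr (- sk / (2 * sk + k + 1)) \<le> real n powr (- rate_exponent k sk)"
      using rate_exponent_le[OF assms(1) sk'(1)] n by (intro powr_mono) auto
    then have "ennreal (C * real n powr (- sk / (2 * sk + k + 1))) \<le> ennreal (C * real n powr (- rate_exponent k sk))"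
      using C by (intro ennreal_leI mult_left_mono) auto
    with upper[OF f sk' n] show ?thesis by (rule order_trans)
  qed
  have part2: "(\<exists>c>0. \<forall>n\<ge>1. ennreal (c * real n powr (- rate_exponent k s)) \<le> minimax_risk D (0, 0) F n) \<and>
       is_minimax_rate D (0, 0) F (\<lambda>n. real n powr (- s / (2 * s + k + 1)))" if s1: "s \<le> 1"
  proof -
    let ?N = "\<lambda>n. real n powr (- s / (2 * s + k + 1))"
    obtain c where c: "0 < c" and lower: "\<And>n. 1 \<le> n \<Longrightarrow> ennreal (c * ?N n) \<le> minimax_risk D (0, 0) F n"
      unfolding D_def F_def by (rule minimax_lower_bound[OF assms(2) s1 assms(3)]) blast
    have pos: "0 < c * ?N n" "0 < ?N n" if "1 \<le> n" for n using that c by auto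
    have le: "minimax_risk D (0, 0) F n \<le> ennreal (C * ?N n)" if n: "1 \<le> n" for n
    proof -
      let ?h = "real n powr (- 1 / (2 * s + k + 1))"
      have "local_poly_est D (0, 0) (holder_degree s) ?h n \<in> estimators n"
        unfolding D_def by (intro local_poly_est_measurable optimal_bandwidth[OF n assms(2)])
      then have "minimax_risk D (0, 0) F n
          \<le> (SUP f\<in>F. risk D (0, 0) n (local_poly_est D (0, 0) (holder_degree s) ?h n) f)"
        unfolding minimax_risk_def by (rule INF_lower)
      also have "\<dots> \<le> ennreal (C * ?N n)"
        by (intro SUP_least upper) (use n assms(2) in auto)
      finally show ?thesis .
    qed
    have "asymp_le (\<lambda>n. ennreal (?N n)) (minimax_risk D (0, 0) F)"
    proof (rule asymp_leI)
      fix n :: nat assume n: "1 \<le> n"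
      have "0 < ennreal (c * ?N n)" using pos[OF n] by simp
      then show "0 < minimax_risk D (0, 0) F n" using lower[OF n] by (rule less_le_trans)
      have "ennreal (?N n) = ennreal (c * ?N n) * ennreal (1 / c)"
        using c by (simp add: ennreal_mult[symmetric])
      also have "\<dots> \<le> minimax_risk D (0, 0) F n * ennreal (1 / c)"
        using lower[OF n] by (intro mult_right_mono) auto
      finally show "ennreal (?N n) \<le> minimax_risk D (0, 0) F n * ennreal (1 / c)" .
    qed
    moreover have "asymp_le (minimax_risk D (0, 0) F) (\<lambda>n. ennreal (?N n))"
    proof (rule asymp_leI)
      fix n :: nat assume n: "1 \<le> n"
      show "0 < ennreal (?N n)" using pos[OF n] by simp
      show "minimax_risk D (0, 0) F n \<le> ennreal (?N n) * ennreal C"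
        using le[OF n] C by (simp add: ennreal_mult[symmetric] mult.commute)
    qed
    moreover have "- rate_exponent k s = - s / (2 * s + k + 1)"
      using rate_exponent_le_1[OF assms(2) s1] by simp
    ultimately show ?thesis
      using c lower unfolding is_minimax_rate_def by auto
  qed
  show ?thesis
  proof (intro conjI impI)
    show "\<exists>sk. is_arg_max (rate_exponent k) (\<lambda>\<beta>. \<beta> \<in> {0<..s}) sk"
      by (rule rate_exponent_has_arg_max[OF assms(1,2)])
    show "\<exists>C>0. \<forall>sk. is_arg_max (rate_exponent k) (\<lambda>\<beta>. \<beta> \<in> {0<..s}) sk \<longrightarrow>
       (\<forall>f\<in>F. \<forall>n\<ge>1.
          risk D (0, 0) n
            (local_poly_est D (0, 0) (holder_degree sk) (real n powr (- 1 / (2 * sk + k + 1))) n) f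
          \<le> ennreal (C * real n powr (- rate_exponent k sk)))"
      using C part1 by (intro exI[of _ C] conjI allI impI ballI)
    show "\<exists>c>0. \<forall>n\<ge>1. ennreal (c * real n powr (- rate_exponent k s)) \<le> minimax_risk D (0, 0) F n"
      if "s \<le> 1"
      using part2[OF that] by (rule conjunct1)
    show "is_minimax_rate D (0, 0) F (\<lambda>n. real n powr (- s / (2 * s + k + 1)))" if "s \<le> 1"
      using part2[OF that] by (rule conjunct2)
  qed
qed

end
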